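(* Let $k,\ell$ be integers with $2\le \ell<k/2$ and put $p=\max\{\ell,\;k-2\ell-1,\;\lceil k/2\rceil-\ell\}$. Then there exist constants $C>0$ and $n_0$ such that for every $n\ge n_0$ divisible by $k-\ell$, $$\mathrm{sat}(n,k,\ell)\le C\,n^{p}.$$ In other words, $\mathrm{sat}(n,k,\ell)=O(n^p)$ as $n\to\infty$ over integers $n$ divisible by $k-\ell$.
   Context: A $k$-graph is a family of $k$-element subsets (edges) of a finite vertex set. For integers $1\le \ell<k$, an $(\ell,k)$-cycle is a $k$-graph which, for some $s$ divisible by $k-\ell$, consists of distinct vertices $v_1,\dots,v_s$ (cyclically ordered) and the $s/(k-\ell)$ edges $\{v_1,\dots,v_k\},\{v_{k-\ell+1},\dots,v_{2k-\ell}\},\dots,\{v_{s-(k-\ell)+1},\dots,v_s,v_1,\dots,v_\ell\}$ (consecutive edges share exactly $\ell$ vertices). An $(\ell,k)$-cycle in an $n$-vertex $k$-graph $H$ is hamiltonian if it contains all $n$ vertices; $H$ is $\ell$-hamiltonian if it contains a hamiltonian $(\ell,k)$-cycle. A $k$-graph $H$ on $n$ vertices is $\ell$-hamiltonian saturated if $H$ is not $\ell$-hamiltonian, but for every $k$-subset $e$ of the vertex set that is not an edge of $H$, the $k$-graph $H+e$ is $\ell$-hamiltonian. $\mathrm{sat}(n,k,\ell)$ denotes the minimum number of edges of an $\ell$-hamiltonian saturated $k$-graph on $n$ vertices (considered for $n$ divisible by $k-\ell$). *)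

theory Defs
  imports Complex_Main
begin

definition kgraph :: "nat \<Rightarrow> nat \<Rightarrow> nat set set \<Rightarrow> bool" where
  "kgraph n k H \<longleftrightarrow> (\<forall>e\<in>H. e \<subseteq> {0..<n} \<and> card e = k)"

definition cycle_edge :: "nat \<Rightarrow> nat \<Rightarrow> nat \<Rightarrow> (nat \<Rightarrow> nat) \<Rightarrow> nat \<Rightarrow> nat set" where
  "cycle_edge n k l v j = (\<lambda>i. v ((j * (k - l) + i) mod n)) ` {0..<k}"

definition hamiltonian :: "nat \<Rightarrow> nat \<Rightarrow> nat \<Rightarrow> nat set set \<Rightarrow> bool" where
  "hamiltonian n k l H \<longleftrightarrow>
     (k - l) dvd n \<and>
     (\<exists>v. bij_betw v {0..<n} {0..<n} \<and>
          (\<forall>j < n div (k - l). cycle_edge n k l v j \<in> H))"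

definition ham_saturated :: "nat \<Rightarrow> nat \<Rightarrow> nat \<Rightarrow> nat set set \<Rightarrow> bool" where
  "ham_saturated n k l H \<longleftrightarrow>
     kgraph n k H \<and> \<not> hamiltonian n k l H \<and>
     (\<forall>e. e \<subseteq> {0..<n} \<and> card e = k \<and> e \<notin> H \<longrightarrow> hamiltonian n k l (insert e H))"

definition sat :: "nat \<Rightarrow> nat \<Rightarrow> nat \<Rightarrow> nat" where
  "sat n k l = (LEAST m. \<exists>H. ham_saturated n k l H \<and> card H = m)"

end

theory Submission
  imports Defs
begin

text \<open>
  It suffices to find a non-hamiltonian \<open>H0\<close> inside a family of \<open>O(n ^ l)\<close> ``narrow'' \<open>k\<close>-sets such
  that adding any other \<open>k\<close>-set makes it hamiltonian: a maximal non-hamiltonian hypergraph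
  containing \<open>H0\<close> is then saturated and consists of narrow sets. Cut the vertex set into blocks of
  constant size; a set is narrow if the blocks it meets form at most \<open>l\<close> runs of consecutive blocks.

  The obstruction to a hamiltonian cycle in \<open>H0\<close> is one vertex \<open>c\<close>. It lies only in the edges
  \<open>B a \<union> {c}\<close>, and a cycle has to leave such an edge on one side through the \<open>l\<close>-set \<open>P a\<close>, into a
  ``dead'' edge \<open>F \<union> P a\<close>. The only other way out of a dead edge leads to a dead edge of the previous
  block, so the cycle would descend forever.

  A set \<open>e\<close> that is not narrow provides the missing exit. Choose \<open>L \<subseteq> e\<close> with one vertex in the last
  block of each of \<open>l\<close> runs, avoiding the topmost run. The block \<open>a\<close> after the highest of these runs
  does not meet \<open>e\<close>, and \<open>L\<close> together with \<open>P a\<close> and filling vertices is a dead edge, which connects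
  \<open>e\<close> to \<open>B a \<union> {c}\<close>. A similar continuation of \<open>e\<close> on its other side and a sweep through the
  remaining vertices close the cycle.
\<close>

subsection \<open>Hamiltonian cycles\<close>

lemma inj_on_mod_interval:
  assumes "0 < n" shows "inj_on (\<lambda>x. nat (x mod int n)) {t..<t + int n}"
proof (rule inj_onI)
  fix x y assume x: "x \<in> {t..<t + int n}" and y: "y \<in> {t..<t + int n}"
    and e: "nat (x mod int n) = nat (y mod int n)"
  have "x mod int n = y mod int n"
    using e assms by (metis nat_eq_iff2 of_nat_0_less_iff pos_mod_sign nat_0_le)
  then have "int n dvd x - y" by (simp add: mod_eq_dvd_iff)
  moreover have "\<bar>x - y\<bar> < int n" using x y by auto
  ultimately show "x = y" using zdvd_imp_le[of "int n" "\<bar>x - y\<bar>"] by auto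
qed

text \<open>The cycle is unrolled over the integers, so that one can walk along it in both
  directions without reducing indices. As \<open>4 * k \<le> n\<close>, three consecutive edges fit
  into one period, where reduction modulo \<open>n\<close> is injective; \<open>2 * l < k\<close>
  separates edges at distance two.\<close>

lemma hamiltonian_edge_sequence:
  assumes "hamiltonian n k l H" "2 * l < k" "4 * k \<le> n"
  obtains E :: "int \<Rightarrow> nat set" where
    "\<And>i. E i \<in> H" "\<And>i. card (E i \<inter> E (i + 1)) = l" "\<And>i. E i \<inter> E (i + 2) = {}"
    "\<And>x. x < n \<Longrightarrow> \<exists>i. x \<in> E i"
proof -
  define d where "d = k - l"
  obtain v where dn: "d dvd n" and v: "bij_betw v {0..<n} {0..<n}"
    and e: "\<And>j. j < n div d \<Longrightarrow> cycle_edge n k l v j \<in> H"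
    using assms(1) by (auto simp: hamiltonian_def d_def)
  have d: "0 < d" "k \<le> 2 * d" "d + l = k" "d \<le> k" using assms by (auto simp: d_def)
  have n: "0 < n" using assms d by linarith
  define m where "m = n div d"
  have nm: "n = m * d" using dn by (simp add: m_def)
  have m: "0 < m" using n nm by (cases m) auto
  define r where "r x = nat (x mod int n)" for x :: int
  have r: "r x < n" for x using n by (simp add: r_def nat_less_iff)
  define J where "J i = {i * int d..<i * int d + int k}" for i :: int
  define E where "E i = v ` r ` J i" for i
  have inj: "inj_on (v \<circ> r) {t..<t + int n}" for t
  proof (rule comp_inj_on)
    show "inj_on r {t..<t + int n}" unfolding r_def by (rule inj_on_mod_interval[OF n])
    show "inj_on v (r ` {t..<t + int n})"
      by (rule inj_on_subset[OF bij_betw_imp_inj_on[OF v]]) (use r in auto)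
  qed
  have cap: "E i \<inter> E j = (v \<circ> r) ` (J i \<inter> J j)" if "J i \<union> J j \<subseteq> {t..<t + int n}" for i j t
    unfolding E_def image_image[symmetric] image_comp
    by (rule inj_on_image_Int[OF inj[of t], symmetric]) (use that in auto)
  have E_edge: "E i = cycle_edge n k l v (nat (i mod int m))" for i
  proof -
    have "r (i * int d + int j) = (nat (i mod int m) * d + j) mod n" for j
    proof -
      have "i * int d mod int n = (i mod int m) * int d" by (simp add: nm mod_mult_mult2)
      then have "(i * int d + int j) mod int n = ((i mod int m) * int d + int j) mod int n"
        by (metis mod_add_left_eq)
      also have "\<dots> = int ((nat (i mod int m) * d + j) mod n)" using m by (simp add: zmod_int)
      finally show ?thesis by (simp add: r_def)
    qed
    moreover have "J i = (\<lambda>j. i * int d + int j) ` {0..<k}"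
    proof (intro set_eqI iffI)
      fix x assume "x \<in> J i"
      then have "x = i * int d + int (nat (x - i * int d))" "nat (x - i * int d) \<in> {0..<k}"
        by (auto simp: J_def)
      then show "x \<in> (\<lambda>j. i * int d + int j) ` {0..<k}" by (rule image_eqI)
    qed (auto simp: J_def)
    ultimately show ?thesis unfolding E_def cycle_edge_def d_def[symmetric]
      by (simp add: image_image)
  qed
  show thesis
  proof (rule that)
    fix i
    have "nat (i mod int m) < m" using m by (simp add: nat_less_iff)
    then show "E i \<in> H" unfolding E_edge using e by (simp add: m_def)
    have "J i \<union> J (i + 1) \<subseteq> {i * int d..<i * int d + int n}"
      using assms d by (auto simp: J_def algebra_simps)
    note c = cap[OF this]
    have "J i \<inter> J (i + 1) = {(i + 1) * int d..<i * int d + int k}"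
      by (auto simp: J_def algebra_simps)
    then have "card (J i \<inter> J (i + 1)) = l" using d by (simp add: algebra_simps)
    moreover have "inj_on (v \<circ> r) (J i \<inter> J (i + 1))"
      by (rule inj_on_subset[OF inj[of "i * int d"]]) (use assms d in \<open>auto simp: J_def\<close>)
    ultimately show "card (E i \<inter> E (i + 1)) = l" unfolding c by (simp only: card_image)
    have "J i \<union> J (i + 2) \<subseteq> {i * int d..<i * int d + int n}"
      using assms d by (auto simp: J_def algebra_simps)
    note c = cap[OF this]
    have "J i \<inter> J (i + 2) = {}" using d by (auto simp: J_def algebra_simps)
    then show "E i \<inter> E (i + 2) = {}" unfolding c by simp
  next
    fix x assume "x < n"
    then have "x \<in> v ` {0..<n}" using v by (simp add: bij_betw_def)
    then obtain y where y: "y < n" "x = v y" by auto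
    have "int y \<in> J (int (y div d))"
    proof -
      have "y div d * d \<le> y" "y < y div d * d + k"
        using div_mult_mod_eq[of y d] mod_less_divisor[OF d(1), of y] d(4) by linarith+
      then show ?thesis unfolding J_def
        by (simp flip: of_nat_mult of_nat_add)
    qed
    moreover have "r (int y) = y" using y by (simp add: r_def)
    ultimately have "y \<in> r ` J (int (y div d))" by (rule_tac image_eqI[where x = "int y"]) simp_all
    then have "x \<in> E (int (y div d))" unfolding E_def y(2) by (rule imageI)
    then show "\<exists>i. x \<in> E i" ..
  qed
qed

lemma hamiltonian_mono: "hamiltonian n k l H \<Longrightarrow> H \<subseteq> H' \<Longrightarrow> hamiltonian n k l H'"
  unfolding hamiltonian_def by blast

text \<open>Hamiltonicity is monotone, so a maximal non-hamiltonian \<open>H\<close> above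
  \<open>H\<^sub>0\<close> contains no \<open>e\<close> outside \<open>N\<close>: it would contain
  the hamiltonian \<open>insert e H\<^sub>0\<close>.\<close>

lemma saturated_extension:
  assumes "kgraph n k H\<^sub>0" "\<not> hamiltonian n k l H\<^sub>0" "H\<^sub>0 \<subseteq> N" "finite N"
    and wide: "\<And>e. e \<subseteq> {0..<n} \<Longrightarrow> card e = k \<Longrightarrow> e \<notin> N \<Longrightarrow> hamiltonian n k l (insert e H\<^sub>0)"
  obtains H where "ham_saturated n k l H" "card H \<le> card N"
proof -
  define \<F> where "\<F> = {H. H\<^sub>0 \<subseteq> H \<and> kgraph n k H \<and> \<not> hamiltonian n k l H}"
  have "\<F> \<subseteq> Pow (Pow {0..<n})" by (auto simp: \<F>_def kgraph_def)
  then have "finite \<F>" by (rule finite_subset) simp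
  moreover have "H\<^sub>0 \<in> \<F>" using assms by (simp add: \<F>_def)
  ultimately obtain H where H: "H \<in> \<F>" and max: "\<And>H'. H' \<in> \<F> \<Longrightarrow> H \<subseteq> H' \<Longrightarrow> H' = H"
    using finite_has_maximal2 by metis
  have "hamiltonian n k l (insert e H)" if "e \<subseteq> {0..<n}" "card e = k" "e \<notin> H" for e
  proof (rule ccontr)
    assume "\<not> hamiltonian n k l (insert e H)"
    then have "insert e H \<in> \<F>" using H that by (auto simp: \<F>_def kgraph_def)
    then show False using max[of "insert e H"] that by auto
  qed
  then have "ham_saturated n k l H" using H by (simp add: ham_saturated_def \<F>_def)
  moreover have "H \<subseteq> N"
  proof (rule ccontr)
    assume "\<not> H \<subseteq> N"
    then obtain e where e: "e \<in> H" "e \<notin> N" by blast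
    then have "hamiltonian n k l (insert e H\<^sub>0)" using wide H by (auto simp: \<F>_def kgraph_def)
    moreover have "insert e H\<^sub>0 \<subseteq> H" using e H by (auto simp: \<F>_def)
    ultimately show False using H hamiltonian_mono by (auto simp: \<F>_def)
  qed
  then have "card H \<le> card N" using assms(4) by (rule card_mono[rotated])
  ultimately show thesis by (rule that)
qed

section \<open>Hamiltonian cycles given by lists\<close>

lemma window_image:
  assumes "i + k \<le> length xs"
  shows "set (take k (drop i xs)) = (\<lambda>j. xs ! (i + j)) ` {0..<k}"
  using assms by (force simp: set_conv_nth)

text \<open>As \<open>l < k - l\<close>, only the last edge runs past the end of the list; it
  consists of the last \<open>k - l\<close> and the first \<open>l\<close> entries.\<close>

lemma hamiltonian_listI:
  assumes dvd: "(k - l) dvd n" and lk: "2 * l < k" "k \<le> n" and xs: "distinct xs" "set xs = {0..<n}"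
    and w: "\<And>j. j * (k - l) + k \<le> n \<Longrightarrow> set (take k (drop (j * (k - l)) xs)) \<in> H"
    and wrap: "set (drop (n - (k - l)) xs @ take l xs) \<in> H"
  shows "hamiltonian n k l H"
proof -
  define d where "d = k - l"
  have len: "length xs = n" using xs distinct_card[of xs] by simp
  have d: "0 < d" "k = d + l" "l < d" using lk by (auto simp: d_def)
  have bij: "bij_betw (\<lambda>i. xs ! i) {0..<n} {0..<n}"
    using bij_betw_nth[OF xs(1) refl refl] by (simp only: xs(2) len lessThan_atLeast0)
  have "cycle_edge n k l (\<lambda>i. xs ! i) j \<in> H" if j: "j < n div (k - l)" for j
  proof (cases "j * d + k \<le> n")
    case True
    have "set (take k (drop (j * d) xs)) = (\<lambda>i. xs ! (j * d + i)) ` {0..<k}"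
      by (rule window_image) (use True len in simp)
    also have "\<dots> = cycle_edge n k l (\<lambda>i. xs ! i) j"
      unfolding cycle_edge_def d_def[symmetric] by (rule image_cong) (use True in auto)
    finally show ?thesis using w[of j] True by (simp add: d_def)
  next
    case False
    obtain m where m: "n = m * d" using dvd unfolding d_def dvd_def by (metis mult.commute)
    have jm: "j < m" using j d by (simp add: m flip: d_def)
    have "\<not> j + 2 \<le> m"
    proof
      assume "j + 2 \<le> m"
      then have "(j + 2) * d \<le> n" unfolding m by (intro mult_le_mono1)
      then show False using False d by simp
    qed
    then have "m = j + 1" using jm by simp
    then have jd: "j * d = n - d" "d \<le> n" by (simp_all add: m)
    have "cycle_edge n k l (\<lambda>i. xs ! i) j = (\<lambda>i. xs ! ((n - d + i) mod n)) ` ({0..<d} \<union> {d..<k})"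
      unfolding cycle_edge_def d_def[symmetric] jd using d by (simp add: ivl_disj_un)
    also have "\<dots> = (\<lambda>i. xs ! ((n - d + i) mod n)) ` {0..<d} \<union> (\<lambda>i. xs ! ((n - d + i) mod n)) ` {d..<k}"
      by (rule image_Un)
    also have "(\<lambda>i. xs ! ((n - d + i) mod n)) ` {0..<d} = (\<lambda>i. xs ! (n - d + i)) ` {0..<d}"
      by (rule image_cong) (use jd in auto)
    also have "\<dots> = set (take d (drop (n - d) xs))"
      by (rule window_image[symmetric]) (use jd len in simp)
    also have "take d (drop (n - d) xs) = drop (n - d) xs" using len by simp
    also have "(\<lambda>i. xs ! ((n - d + i) mod n)) ` {d..<k} = (\<lambda>i. xs ! (0 + i)) ` {0..<l}"
    proof -
      have "{d..<k} = (\<lambda>i. i + d) ` {0..<l}" by (simp add: d add.commute)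
      moreover have "(n - d + (i + d)) mod n = i" if "i < l" for i
        using that jd lk by simp
      ultimately show ?thesis by (simp only: image_image) (rule image_cong, simp_all)
    qed
    also have "\<dots> = set (take l (drop 0 xs))"
      by (rule window_image[symmetric]) (use lk len in simp)
    finally show ?thesis using wrap by (simp add: d_def)
  qed
  then show ?thesis using dvd bij unfolding hamiltonian_def by blast
qed

text \<open>The first edge \<open>L, M, take l A\<close> is to be the new one. \<open>A\<close>
  starts an edge, and by its length at most two edges start in it. The last two edges are
  \<open>Y, Z, P\<close> and, wrapping around, \<open>P, F, L\<close>. Those in between are windows
  of \<open>mid @ Y\<close> at offsets that depend on \<open>length A\<close>, so the condition is
  imposed at all offsets.\<close>

lemma hamiltonian_assembly:
  assumes dvd: "(k - l) dvd n" and lk: "0 < l" "2 * l < k"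
    and dist: "distinct (L @ M @ A @ mid @ Y @ Z @ P @ F)"
    and set: "set (L @ M @ A @ mid @ Y @ Z @ P @ F) = {0..<n}"
    and len: "length L = l" "length M = k - 2 * l" "l \<le> length A" "length A \<le> 2 * (k - l)"
      "2 * k \<le> length mid" "length Y = l" "length Z = k - 2 * l" "length P = l" "length F = k - 2 * l"
    and e: "set (L @ M @ take l A) \<in> H"
    and start: "set (take k (A @ mid)) \<in> H" "set (take k (drop (k - l) (A @ mid))) \<in> H"
    and middle: "\<And>i. i + k \<le> length (mid @ Y) \<Longrightarrow> set (take k (drop i (mid @ Y))) \<in> H"
    and stop: "set (Y @ Z @ P) \<in> H" "set (P @ F @ L) \<in> H"
  shows "hamiltonian n k l H"
proof -
  define d where "d = k - l"
  define xs where "xs = L @ M @ A @ mid @ Y @ Z @ P @ F"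
  have d: "0 < d" "k = d + l" "l < d" "k - 2 * l = d - l" using lk by (auto simp: d_def)
  have n: "n = length xs" using dist set distinct_card[of xs] by (simp add: xs_def)
  have n': "n = length A + length mid + 3 * d" using n len d by (simp add: xs_def)
  show ?thesis
  proof (rule hamiltonian_listI[OF dvd lk(2)])
    show "k \<le> n" using n' len d by simp
    show "distinct xs" "set xs = {0..<n}" using dist set by (simp_all add: xs_def)
    have "drop (n - d) xs = P @ F" unfolding xs_def using n' len d by simp
    moreover have "take l xs = L" unfolding xs_def using len by simp
    ultimately show "set (drop (n - (k - l)) xs @ take l xs) \<in> H"
      using stop(2) by (simp add: d_def Un_ac)
    fix j assume j: "j * (k - l) + k \<le> n"
    show "set (take k (drop (j * (k - l)) xs)) \<in> H"
    proof (cases j)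
      case 0
      have "take k xs = L @ M @ take l A" unfolding xs_def using len d by simp
      then show ?thesis using e 0 by simp
    next
      case (Suc i)
      have dr: "drop (j * (k - l)) xs = drop (i * d) (A @ mid @ Y @ Z @ P @ F)"
        unfolding xs_def Suc using len d by (simp flip: d_def)
      obtain m where m: "n = m * d" using dvd unfolding d_def dvd_def by (metis mult.commute)
      have jd: "j * d + d + l \<le> m * d" using j d by (simp add: m flip: d_def)
      have "j + 2 \<le> m"
      proof (rule ccontr)
        assume "\<not> j + 2 \<le> m"
        then have "m * d \<le> (j + 1) * d" by (intro mult_le_mono1) simp
        then show False using jd lk by simp
      qed
      consider "i = 0" | "i = 1" | "i \<ge> 2" "j + 2 = m" | "i \<ge> 2" "j + 3 \<le> m"
        using \<open>j + 2 \<le> m\<close> by linarith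
      then show ?thesis
      proof cases
        case 1
        have "take k (drop (i * d) (A @ mid @ Y @ Z @ P @ F)) = take k (A @ mid)"
          using 1 len by simp
        then show ?thesis using start(1) dr by simp
      next
        case 2
        have "take k (drop (i * d) (A @ mid @ Y @ Z @ P @ F)) = take k (drop d (A @ mid))"
          using 2 len d by simp
        then show ?thesis using start(2) dr by (simp add: d_def)
      next
        case 3
        \<comment> \<open>\<open>Y\<close>, \<open>Z\<close>, \<open>P\<close> and \<open>F\<close>
          together take up exactly two strides, so the last edge but one starts at
          \<open>Y\<close>.\<close>
        have "i * d + d + 2 * d = n" using 3(2) Suc by (simp add: m flip: add_mult_distrib) 
        then have "i * d = length A + length mid" using n' by simp
        then have "take k (drop (i * d) (A @ mid @ Y @ Z @ P @ F)) = Y @ Z @ P"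
          using len d by simp
        then show ?thesis using stop(1) dr by simp
      next
        case 4
        have "(j + 3) * d \<le> n" unfolding m by (intro mult_le_mono1 4)
        then have i1: "i * d + k \<le> length A + length mid + l" using n' Suc d by (simp add: algebra_simps)
        have "length A \<le> 2 * d" using len by (simp add: d_def)
        also have "2 * d \<le> i * d" by (intro mult_le_mono1 4)
        finally have i2: "length A \<le> i * d" .
        have "take k (drop (i * d) (A @ mid @ Y @ Z @ P @ F)) = take k (drop (i * d - length A) ((mid @ Y) @ Z @ P @ F))"
          using i2 by simp
        also have "\<dots> = take k (drop (i * d - length A) (mid @ Y))"
          using i1 i2 len by (subst drop_append, subst take_append) simp
        finally show ?thesis using middle[of "i * d - length A"] i1 i2 len dr by simp
      qed
    qed
  qed
qed

text \<open>Consecutive entries skip only members of \<open>R\<close>, so \<open>j + 1\<close>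
  entries span at most \<open>j + 1 + card R\<close> numbers.\<close>

lemma sorted_window:
  assumes "finite R" "card R \<le> q" "m \<le> k" "xs = sorted_list_of_set ({0..<N} - R)"
  obtains x where "set (take m (drop i xs)) \<subseteq> {x..<x + (k + q)}"
proof (cases "i < length xs")
  case False then show thesis using that by simp
next
  case i: True
  have xs: "sorted_wrt (<) xs" "set xs = {0..<N} - R"
    unfolding assms(4) by (simp_all add: strict_sorted_iff)
  have mono: "xs ! a < xs ! b \<longleftrightarrow> a < b" if "a < length xs" "b < length xs" for a b
    using sorted_wrt_nth_less[OF xs(1)] that by (metis linorder_neqE_nat order_less_asym)
  have "y \<in> {xs ! i..<xs ! i + (k + q)}" if "y \<in> set (take m (drop i xs))" for y
  proof -
    obtain j where "j < length (take m (drop i xs))" "y = take m (drop i xs) ! j"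
      using \<open>y \<in> _\<close> by (metis in_set_conv_nth)
    then have j: "j < m" "i + j < length xs" "y = xs ! (i + j)" by auto
    have le: "xs ! i \<le> y" using mono[of "i + j" i] j i by (simp add: not_less[symmetric])
    have "{xs ! i..y} \<subseteq> R \<union> (\<lambda>t. xs ! t) ` {i..i + j}"
    proof
      fix z assume z: "z \<in> {xs ! i..y}"
      show "z \<in> R \<union> (\<lambda>t. xs ! t) ` {i..i + j}"
      proof (cases "z \<in> R")
        case False
        have "y \<in> set xs" using j by simp
        then have "z \<in> set xs" using z False xs(2) by auto
        then obtain t where t: "t < length xs" "z = xs ! t" by (auto simp: in_set_conv_nth)
        have "t \<in> {i..i + j}" using z t j i mono[of t i] mono[of "i + j" t] by (auto simp: not_less[symmetric])
        then show ?thesis using t by blast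
      qed simp
    qed
    then have "card {xs ! i..y} \<le> card (R \<union> (\<lambda>t. xs ! t) ` {i..i + j})"
      using assms(1) by (intro card_mono) auto
    also have "\<dots> \<le> card R + card ((\<lambda>t. xs ! t) ` {i..i + j})" by (rule card_Un_le)
    also have "\<dots> \<le> q + (j + 1)" using assms(2) card_image_le[of "{i..i + j}" "\<lambda>t. xs ! t"] by simp
    finally show ?thesis using le j assms(3) by simp
  qed
  then show thesis using that by blast
qed

text \<open>Each element of \<open>e\<close> is within distance less than \<open>D\<close> of at
  most one point \<open>g i\<close>, so choosing a near element for every \<open>i\<close> is
  injective.\<close>

lemma card_near:
  fixes g :: "nat \<Rightarrow> nat"
  assumes "finite e" "\<And>i j. i \<in> I \<Longrightarrow> j \<in> I \<Longrightarrow> i < j \<Longrightarrow> g i + 2 * D \<le> g j"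
  shows "card {i \<in> I. \<exists>y\<in>e. g i < y + D \<and> y < g i + D} \<le> card e"
proof (rule card_inj_on_le)
  define h where "h i = (SOME y. y \<in> e \<and> g i < y + D \<and> y < g i + D)" for i
  have h: "h i \<in> e \<and> g i < h i + D \<and> h i < g i + D"
    if "i \<in> {i \<in> I. \<exists>y\<in>e. g i < y + D \<and> y < g i + D}" for i
    unfolding h_def by (rule someI_ex) (use that in auto)
  show "h ` {i \<in> I. \<exists>y\<in>e. g i < y + D \<and> y < g i + D} \<subseteq> e" using h by blast
  show "inj_on h {i \<in> I. \<exists>y\<in>e. g i < y + D \<and> y < g i + D}"
  proof (rule inj_onI)
    fix i j assume i: "i \<in> {i \<in> I. \<exists>y\<in>e. g i < y + D \<and> y < g i + D}"
      and j: "j \<in> {i \<in> I. \<exists>y\<in>e. g i < y + D \<and> y < g i + D}" and e: "h i = h j"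
    show "i = j"
      using h[OF i] h[OF j] e assms(2)[of i j] assms(2)[of j i] i j
      by (cases i j rule: linorder_cases) auto
  qed
qed (rule assms(1))

subsection \<open>The construction\<close>

locale ham_construction =
  fixes k l n T :: nat
  assumes l_ge: "2 \<le> l" and lk: "2 * l < k"
    and n_large: "36 * k * k * (T + 1) + 6 * k + 2 \<le> n"
begin

text \<open>With at most \<open>5 * k\<close> vertices left out of a sorted list, \<open>k\<close>
  consecutive entries fit into an interval of length \<open>k + 5 * k\<close>.\<close>

definition D :: nat where "D = 6 * k"
text \<open>A block holds the points \<open>bp a j\<close> with \<open>j < 5 * k\<close>, with a
  margin \<open>D\<close> at both ends: the first \<open>k - 1\<close> form \<open>B a\<close>,
  those from index \<open>k\<close> on serve as fillers.\<close>

definition s :: nat where "s = D * (6 * k)"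
definition c :: nat where "c = n - 1"

text \<open>
  The \<open>k - 1\<close> vertices of \<open>B a\<close> lie in block \<open>a\<close>, so far apart that an interval of length \<open>D\<close>
  contains at most one of them. A cycle passes through \<open>B a \<union> {c}\<close> from \<open>P a\<close> to \<open>Y a\<close>.
\<close>

definition bp :: "nat \<Rightarrow> nat \<Rightarrow> nat" where "bp a j = s * a + D * (j + 1)"
definition B :: "nat \<Rightarrow> nat set" where "B a = bp a ` {..<k - 1}"
definition P :: "nat \<Rightarrow> nat set" where "P a = bp a ` {..<l}"
definition Y :: "nat \<Rightarrow> nat set" where "Y a = bp a ` {l..<2 * l}"
definition Om :: "nat set" where "Om = {s * T..<c} - P T"
text \<open>The reservoir starts above block \<open>T\<close>, so it avoids every \<open>B a\<close>
  with \<open>a \<le> T\<close> and leaves the lower vertices to one sweep in increasing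
  order.\<close>

definition S0 :: "nat set" where "S0 = {s * (T + 1)..<c}"

text \<open>
  Vertices of \<open>Om\<close> lie in no dead edge, so they can fill up an edge without creating new
  intersections of size \<open>l\<close>.
\<close>

definition live :: "nat set \<Rightarrow> bool" where
  "live h \<longleftrightarrow> h \<subseteq> {0..<n} \<and> card h = k \<and> c \<notin> h \<and>
     ((\<exists>x. h - Om \<subseteq> {x..<x + D}) \<or>
      (\<exists>a<T. h - Om \<subseteq> B a \<and> (card (h - Om) = l \<longrightarrow> h - Om = Y a)) \<or>
      P T \<subseteq> h \<and> card (h - Om - P T) < l \<or>
      h - Om \<subseteq> P T)"

text \<open>
  The third condition leaves at most \<open>l - 1\<close> vertices of \<open>F\<close> below block \<open>a - 1\<close>: two dead edges
  meet in \<open>l\<close> vertices only if their blocks \<open>a\<close> are equal or consecutive.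
\<close>

definition tail_set :: "nat \<Rightarrow> nat set \<Rightarrow> bool" where
  "tail_set a F \<longleftrightarrow> (\<forall>v\<in>F. v div s < a) \<and> card F = k - l \<and>
     k - 2 * l + 1 \<le> card {v \<in> F. v div s = a - 1} \<and>
     card (F \<inter> B (a - 1)) < l \<and> (\<forall>x. card (F \<inter> {x..<x + D}) < l)"

text \<open>Here \<open>a = T\<close> is allowed, while the edges through \<open>c\<close> have
  \<open>a < T\<close>: a new edge that reaches block \<open>T - 1\<close> may have to be continued
  through a dead edge of block \<open>T\<close>.\<close>

definition dead :: "nat \<Rightarrow> nat set \<Rightarrow> bool" where
  "dead a f \<longleftrightarrow> 1 \<le> a \<and> a \<le> T \<and> (\<exists>F. tail_set a F \<and> f = F \<union> P a)"

definition H0 :: "nat set set" where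
  "H0 = {h. live h} \<union> {f. \<exists>a. dead a f} \<union> {insert c (B a) | a. 1 \<le> a \<and> a < T}"

section \<open>Position of the vertices in their blocks\<close>

lemma k_pos: "k > 0" and D_pos: "D > 0" and s_pos: "s > 0"
  using l_ge lk by (auto simp: D_def s_def)

lemma s_large: "s * (T + 1) + 6 * k < c"
proof -
  have "s = 36 * k * k" by (simp add: s_def D_def)
  then show ?thesis using n_large by (simp add: c_def)
qed

lemma c_less: "c < n" using n_large by (simp add: c_def)

lemma bp_bounds:
  assumes "j < 5 * k" shows "s * a + D \<le> bp a j" "bp a j + D \<le> s * (a + 1)"
proof -
  show "s * a + D \<le> bp a j" by (simp add: bp_def)
  have "D * (j + 2) \<le> D * (6 * k)" using assms k_pos by (intro mult_le_mono2) linarith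
  then show "bp a j + D \<le> s * (a + 1)" by (simp add: bp_def s_def algebra_simps)
qed

lemma bp_div: "j < 5 * k \<Longrightarrow> bp a j div s = a"
  using bp_bounds[of j a] D_pos s_pos
  by (intro div_nat_eqI) (auto simp: algebra_simps)

lemma bp_mono: "i < j \<Longrightarrow> bp a i + D \<le> bp a j"
proof -
  assume "i < j"
  then have "D * (i + 2) \<le> D * (j + 1)" by (intro mult_le_mono2) simp
  then show ?thesis by (simp add: bp_def algebra_simps)
qed

lemma bp_inj: "bp a i = bp a j \<longleftrightarrow> i = j"
  using D_pos by (auto simp: bp_def)

lemma B_div: "v \<in> B a \<Longrightarrow> v div s = a"
  unfolding B_def using bp_div by auto

lemma P_sub: "P a \<subseteq> B a" and Y_sub: "Y a \<subseteq> B a" and PY: "P a \<inter> Y a = {}"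
  using lk by (auto simp: P_def Y_def B_def bp_inj)

lemma card_B: "card (B a) = k - 1" and card_P: "card (P a) = l" and card_Y: "card (Y a) = l"
  by (auto simp: B_def P_def Y_def card_image inj_on_def bp_inj)

lemma finite_sets[simp]: "finite (B a)" "finite (P a)" "finite (Y a)" "finite S0" "finite Om"
  by (auto simp: B_def P_def Y_def S0_def Om_def)

lemma P_div: "v \<in> P a \<Longrightarrow> v div s = a" using P_sub B_div by blast

lemma B_ge: "v \<in> B a \<Longrightarrow> s * a + D \<le> v"
  unfolding B_def by (auto simp: bp_def)

lemma P_ne: "P a \<noteq> {}" using card_P[of a] l_ge by auto

lemma card_B_interval: "card (B a \<inter> {x..<x + D}) \<le> 1"
proof -
  have "u = v" if "u \<in> B a \<inter> {x..<x + D}" "v \<in> B a \<inter> {x..<x + D}" for u v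
  proof -
    obtain i j where "u = bp a i" "v = bp a j" using \<open>u \<in> _\<close> \<open>v \<in> _\<close> by (auto simp: B_def)
    then show ?thesis using that bp_mono[of i j a] bp_mono[of j i a] by (cases i j rule: linorder_cases) auto
  qed
  then show ?thesis by (simp add: card_le_Suc0_iff_eq)
qed

lemma less_block_iff: "v < s * a \<longleftrightarrow> v div s < a"
  by (simp add: s_pos div_less_iff_less_mult mult.commute)

lemma sT_less: "s * T < c" using s_large by simp

lemma c_div: "c div s \<ge> T" using less_block_iff[of c T] sT_less by simp

lemma B_less: "v \<in> B a \<Longrightarrow> a < T \<Longrightarrow> v < s * T"
  using B_div by (simp add: less_block_iff)

lemma B_T_less: "v \<in> B a \<Longrightarrow> a \<le> T \<Longrightarrow> v < s * (T + 1)"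
  using B_div[of v a] unfolding less_block_iff by simp

lemma c_notin_B: "a \<le> T \<Longrightarrow> c \<notin> B a"
  using B_T_less[of c a] s_large by auto

lemma B_Om: "a < T \<Longrightarrow> B a \<inter> Om = {}"
  using B_less by (fastforce simp: Om_def)

section \<open>Intersections of size \<open>l\<close>\<close>

lemma dead_finite: assumes "tail_set a F" shows "finite F"
proof -
  have "card F > 0" using assms lk by (simp add: tail_set_def)
  then show ?thesis by (rule card_ge_0_finite)
qed

lemma dead_Om: assumes "tail_set a F" "a \<le> T" shows "(F \<union> P a) \<inter> Om = {}"
proof -
  have "F \<inter> Om = {}" using assms by (auto simp: tail_set_def Om_def less_block_iff[symmetric]) 
      (metis less_block_iff order_less_le_trans not_le)
  moreover have "P a \<inter> Om = {}"
  proof (cases "a = T")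
    case True then show ?thesis by (auto simp: Om_def)
  next
    case False then show ?thesis using assms B_Om[of a] P_sub[of a] by auto
  qed
  ultimately show ?thesis by blast
qed

text \<open>Of the \<open>k - l\<close> vertices of \<open>F\<close> at least
  \<open>k - 2 * l + 1\<close> lie in block \<open>a - 1\<close>; at most \<open>l - 1\<close> are
  left.\<close>

lemma card_below_top_block:
  assumes "tail_set a F" "\<And>v. v \<in> X \<Longrightarrow> v \<in> F \<and> v div s \<noteq> a - 1"
  shows "card X < l"
proof -
  have f: "finite F" using assms(1) dead_finite by blast
  let ?U = "{v \<in> F. v div s = a - 1}"
  have "card X \<le> card (F - ?U)" using f assms(2) by (intro card_mono) auto
  also have "\<dots> = card F - card ?U" using f by (intro card_Diff_subset) auto
  also have "\<dots> < l" using assms(1) lk l_ge by (auto simp: tail_set_def)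
  finally show ?thesis .
qed

lemma tail_P: "tail_set a F \<Longrightarrow> v \<in> F \<Longrightarrow> v \<notin> P b" if "a \<le> b"
  using that P_div by (fastforce simp: tail_set_def)

lemma tail_B:
  assumes "tail_set a F" "a \<ge> 1" "b \<noteq> a"
  shows "card ((F \<union> P a) \<inter> B b) < l"
proof -
  have e: "(F \<union> P a) \<inter> B b = F \<inter> B b" using assms(3) P_div B_div by blast
  show ?thesis
  proof (cases "b = a - 1")
    case True then show ?thesis using assms(1) unfolding e by (simp add: tail_set_def)
  next
    case False
    then show ?thesis unfolding e by (intro card_below_top_block[OF assms(1)]) (auto dest: B_div)
  qed
qed

lemma dead_cap_B: assumes "tail_set a F" shows "(F \<union> P a) \<inter> B a = P a"
proof -
  have "F \<inter> B a = {}" using assms B_div by (fastforce simp: tail_set_def)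
  then show ?thesis using P_sub by blast
qed

lemma dead_not_c: assumes "dead a f" shows "c \<notin> f"
proof -
  obtain F where F: "tail_set a F" "f = F \<union> P a" "a \<le> T" using assms by (auto simp: dead_def)
  have "c \<notin> F" using F c_div by (fastforce simp: tail_set_def)
  then show ?thesis using F c_notin_B[of a] P_sub by auto
qed

text \<open>Each alternative in \<open>live\<close> yields either \<open>P a\<close> or fewer than
  \<open>l\<close> common vertices. Since edges at distance two are disjoint, at most one neighbour
  of a dead edge in a cycle can then be live.\<close>

lemma live_dead:
  assumes "live h" "dead a f" "card (f \<inter> h) = l"
  shows "P a \<subseteq> h"
proof -
  obtain F where F: "tail_set a F" "f = F \<union> P a" and a: "1 \<le> a" "a \<le> T"
    using assms by (auto simp: dead_def)
  have fF: "finite F" using F dead_finite by blast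
  define W where "W = h - Om"
  have fh: "finite h" using assms(1) k_pos by (intro card_ge_0_finite) (simp add: live_def)
  have fW: "f \<inter> h = f \<inter> W" using dead_Om[OF F(1) a(2)] by (auto simp: W_def F)
  have eqP: "P a \<subseteq> h" if "f \<inter> W \<subseteq> P a"
    using card_subset_eq[OF finite_sets(2) that] assms(3) by (auto simp: card_P fW W_def)
  consider (i) x where "W \<subseteq> {x..<x + D}" | (b) b where "b < T" "W \<subseteq> B b"
    | (t) "P T \<subseteq> h" "card (W - P T) < l" | (w) "W \<subseteq> P T"
    using assms(1) unfolding live_def W_def by blast
  then show ?thesis
  proof cases
    case i
    have "card (f \<inter> W) < l"
    proof (cases "P a \<inter> W = {}")
      case True
      then have "f \<inter> W \<subseteq> F \<inter> {x..<x + D}" using i F by auto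
      then have "card (f \<inter> W) \<le> card (F \<inter> {x..<x + D})" by (intro card_mono) auto
      then show ?thesis using F(1) by (auto simp: tail_set_def intro: le_less_trans)
    next
      case False
      then obtain p where p: "p \<in> P a" "p \<in> W" by blast
      \<comment> \<open>\<open>P a\<close> starts at distance at least \<open>D\<close> above the
        lower end of block \<open>a\<close>, and \<open>F\<close> lies below that block, so an
        interval of length \<open>D\<close> cannot meet both.\<close>
      have "F \<inter> W = {}"
      proof (rule ccontr)
        assume "F \<inter> W \<noteq> {}"
        then obtain q where q: "q \<in> F" "q \<in> W" by blast
        have "q < s * a" using q F(1) by (auto simp: tail_set_def less_block_iff)
        moreover have "s * a + D \<le> p" using p B_ge P_sub by blast
        moreover have "p < x + D" "x \<le> q" using p q i by auto
        ultimately show False by linarith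
      qed
      then have "f \<inter> W \<subseteq> B a \<inter> {x..<x + D}" using i F P_sub by auto
      then have "card (f \<inter> W) \<le> card (B a \<inter> {x..<x + D})" by (intro card_mono) auto
      then show ?thesis using card_B_interval[of a x] l_ge by linarith
    qed
    then show ?thesis using assms(3) fW by simp
  next
    case b
    show ?thesis
    proof (cases "b = a")
      case True
      then have "f \<inter> W \<subseteq> P a" using b dead_cap_B[OF F(1)] F(2) by blast
      then show ?thesis by (rule eqP)
    next
      case False
      have "card (f \<inter> W) \<le> card ((F \<union> P a) \<inter> B b)" using b F by (intro card_mono) auto
      then show ?thesis using tail_B[OF F(1) a(1) False] assms(3) fW by simp
    qed
  next
    case t
    show ?thesis
    proof (cases "a = T")
      case True then show ?thesis using t by simp
    next
      case False
      have "f \<inter> P T = {}" using False a tail_P[of a T F] F P_div by blast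
      then have "f \<inter> W \<subseteq> W - P T" by blast
      then have "card (f \<inter> W) \<le> card (W - P T)" using fh by (intro card_mono) (auto simp: W_def)
      then show ?thesis using t assms(3) fW by simp
    qed
  next
    case w
    show ?thesis
    proof (cases "a = T")
      case True 
      have "f \<inter> W \<subseteq> P a" using w True by auto
      then show ?thesis by (rule eqP)
    next
      case False
      have "f \<inter> P T = {}" using False a tail_P[of a T F] F P_div by blast
      then show ?thesis using w assms(3) fW l_ge by (metis Int_mono card.empty not_numeral_le_zero order_refl subset_empty)
    qed
  qed
qed

text \<open>The clause about size \<open>l\<close> in \<open>live\<close> is made for this: an edge
  \<open>B a \<union> {c}\<close> can be left into a live edge only through \<open>Y a\<close>,
  which a cycle can use on one side only.\<close>

lemma live_B:
  assumes "live h" "a < T" "card (h \<inter> B a) = l"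
  shows "h \<inter> B a = Y a"
proof -
  define W where "W = h - Om"
  have fh: "finite h" using assms(1) k_pos by (intro card_ge_0_finite) (simp add: live_def)
  have fW: "h \<inter> B a = W \<inter> B a" using B_Om[OF assms(2)] by (auto simp: W_def)
  consider (i) x where "W \<subseteq> {x..<x + D}" | (b) b where "b < T" "W \<subseteq> B b" "card W = l \<longrightarrow> W = Y b"
    | (t) "card (W - P T) < l" | (w) "W \<subseteq> P T"
    using assms(1) unfolding live_def W_def by blast
  then show ?thesis
  proof cases
    case i
    then have "card (W \<inter> B a) \<le> card (B a \<inter> {x..<x + D})" by (intro card_mono) auto
    then show ?thesis using card_B_interval[of a x] assms(3) fW l_ge by simp
  next
    case b
    show ?thesis
    proof (cases "b = a")
      case True then show ?thesis using b assms(3) fW by (auto simp: Int_absorb2)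
    next
      case False
      then have "W \<inter> B a = {}" using b B_div by blast
      then show ?thesis using assms(3) fW l_ge by simp
    qed
  next
    case t
    have "W \<inter> B a \<subseteq> W - P T" using P_div B_div assms(2) by blast
    then have "card (W \<inter> B a) \<le> card (W - P T)" using fh by (intro card_mono) (auto simp: W_def)
    then show ?thesis using t assms(3) fW by simp
  next
    case w
    then have "W \<inter> B a = {}" using P_div B_div assms(2) by blast
    then show ?thesis using assms(3) fW l_ge by simp
  qed
qed

text \<open>The vertices of \<open>f\<close> lie in blocks up to \<open>a < b\<close>, so common
  ones belong to the tail of \<open>h\<close>. If none were in block \<open>b - 1\<close>, there
  would be fewer than \<open>l\<close>. One in that block forces \<open>b - 1 = a\<close>; it is
  then not in the tail of \<open>f\<close>, hence in \<open>P a\<close>.\<close>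

lemma dead_dead:
  assumes "dead a f" "dead b h" "a < b" "card (f \<inter> h) = l"
  shows "b = a + 1 \<and> h \<inter> P a \<noteq> {}"
proof (rule ccontr)
  assume neg: "\<not> ?thesis"
  obtain F where F: "tail_set a F" "f = F \<union> P a" using assms by (auto simp: dead_def)
  obtain G where G: "tail_set b G" "h = G \<union> P b" using assms by (auto simp: dead_def)
  have low: "v div s \<le> a" if "v \<in> f" for v using that F P_div by (fastforce simp: tail_set_def)
  have inG: "v \<in> G" if "v \<in> f \<inter> h" for v using that low[of v] assms(3) G P_div by fastforce
  have "card (f \<inter> h) < l"
  proof (rule card_below_top_block[OF G(1)])
    fix v assume v: "v \<in> f \<inter> h"
    have "v div s \<noteq> b - 1"
    proof
      assume e: "v div s = b - 1"
      then have b: "b = a + 1" using low[of v] v assms(3) by auto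
      then have "v \<notin> F" using e F(1) by (auto simp: tail_set_def)
      then show False using neg b v F by auto
    qed
    then show "v \<in> G \<and> v div s \<noteq> b - 1" using inG[OF v] by simp
  qed
  then show False using assms(4) by simp
qed

subsection \<open>The initial hypergraph is not hamiltonian\<close>

text \<open>These properties of an unrolled cycle survive reversal, so a statement about the next
  edge also gives one about the previous edge.\<close>

definition cyc :: "(int \<Rightarrow> nat set) \<Rightarrow> bool" where
  "cyc E \<longleftrightarrow> (\<forall>i. E i \<in> H0 \<and> card (E i \<inter> E (i + 1)) = l \<and> E i \<inter> E (i + 2) = {})"

lemma cyc_rev: "cyc E \<Longrightarrow> cyc (\<lambda>i. E (- i))"
  unfolding cyc_def
proof safe
  fix i assume *: "\<forall>i. E i \<in> H0 \<and> card (E i \<inter> E (i + 1)) = l \<and> E i \<inter> E (i + 2) = {}"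
  show "E (- i) \<in> H0" using * by blast
  have "card (E (- (i + 1)) \<inter> E (- (i + 1) + 1)) = l" using * by blast
  moreover have "- (i + 1) + 1 = - i" by simp
  ultimately show "card (E (- i) \<inter> E (- (i + 1))) = l" by (simp only: Int_commute)
  fix x assume x: "x \<in> E (- i)" "x \<in> E (- (i + 2))"
  have "E (- (i + 2)) \<inter> E (- (i + 2) + 2) = {}" using * by blast
  moreover have "- (i + 2) + 2 = - i" by simp
  ultimately show "x \<in> {}" using x by auto
qed

lemma dead_B: assumes "dead a f" "a' \<noteq> a" shows "card (f \<inter> insert c (B a')) < l"
proof -
  have "f \<inter> insert c (B a') = f \<inter> B a'" using dead_not_c[OF assms(1)] by auto
  then show ?thesis using assms tail_B by (auto simp: dead_def)
qed

text \<open>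
  A dead edge that is entered through \<open>P a\<close>, or from a dead edge of block \<open>a + 1\<close>, can only be
  left into a dead edge of block \<open>a - 1\<close>, which is impossible forever.
\<close>

lemma descent:
  assumes "cyc E" "dead a (E i)" "E (i - 1) \<inter> P a \<noteq> {}"
    and "P a \<subseteq> E (i - 1) \<or> P (a + 1) \<subseteq> E (i - 1)"
  shows False
  using assms(2-)
proof (induction a arbitrary: i rule: less_induct)
  case (less a)
  have Pf: "P a \<subseteq> E i" using less.prems(1) by (auto simp: dead_def)
  have c1: "card (E i \<inter> E (i + 1)) = l" and H: "E (i + 1) \<in> H0" using assms(1) by (auto simp: cyc_def)
  have "E (i - 1) \<inter> E (i - 1 + 2) = {}" using assms(1) unfolding cyc_def by blast
  then have dis: "E (i - 1) \<inter> E (i + 1) = {}" by (simp add: algebra_simps)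
  have nP: "\<not> P a \<subseteq> E (i + 1)" using less.prems(2) dis by blast
  consider "live (E (i + 1))" | b where "dead b (E (i + 1))"
    | b where "E (i + 1) = insert c (B b)"
    using H by (auto simp: H0_def)
  then show False
  proof cases
    case 1
    then show False using live_dead less.prems(1) c1 nP by blast
  next
    case (2 b)
    consider "b = a" | "b > a" | "b < a" by linarith
    then show False
    proof cases
      case 1 then show False using 2 nP by (auto simp: dead_def)
    next
      case gt: 2
      then have "b = a + 1" "E (i + 1) \<inter> P a \<noteq> {}" using dead_dead[OF less.prems(1) 2 gt c1] by auto
      \<comment> \<open>Whichever of \<open>P a\<close> and \<open>P (a + 1)\<close> lies in
        \<open>E (i - 1)\<close>, it meets \<open>E (i + 1)\<close>, contrary to
        \<open>dis\<close>.\<close>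
      moreover have "P b \<subseteq> E (i + 1)" using 2 by (auto simp: dead_def)
      ultimately show False using less.prems(3) dis P_ne[of b] by blast
    next
      case lt: 3
      \<comment> \<open>The descent goes on with block \<open>a - 1\<close> at the next edge;
        \<open>P a \<subseteq> E i\<close> becomes the second alternative of its last
        hypothesis.\<close>
      have "a = b + 1" "E i \<inter> P b \<noteq> {}"
        using dead_dead[OF 2 less.prems(1) lt] c1 by (auto simp: Int_commute)
      then show False using less.IH[OF lt, of "i + 1"] 2 Pf by simp
    qed
  next
    case (3 b)
    then show False
    proof (cases "b = a")
      case True then show False using 3 nP P_sub by blast
    next
      case False then show False using dead_B[OF less.prems(1) False] c1 3 by simp
    qed
  qed
qed

text \<open>A live neighbour would use \<open>Y a\<close>; a dead one belongs to block
  \<open>a\<close> and is entered through \<open>P a\<close>, which starts a descent; another edge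
  through \<open>c\<close> shares either all \<open>k\<close> vertices or only
  \<open>c\<close>.\<close>

lemma no_turn:
  assumes E: "cyc E" and g: "E i = insert c (B a)" "1 \<le> a" "a < T"
    and ne: "E i \<inter> E (i + 1) \<noteq> Y a"
  shows False
proof -
  have c1: "card (E i \<inter> E (i + 1)) = l" and H: "E (i + 1) \<in> H0" using E by (auto simp: cyc_def)
  consider "live (E (i + 1))" | b where "dead b (E (i + 1))"
    | b where "E (i + 1) = insert c (B b)" "b < T"
    using H by (auto simp: H0_def)
  then show False
  proof cases
    case 1
    then have "E i \<inter> E (i + 1) = E (i + 1) \<inter> B a" using g by (auto simp: live_def)
    then show False using live_B[OF 1 g(3)] c1 ne by simp
  next
    case (2 b)
    have "b = a" using dead_B[OF 2, of a] c1 g by (auto simp: Int_commute)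
    then show False using descent[OF E, of a "i + 1"] 2 g P_ne[of a] P_sub[of a] by auto
  next
    case (3 b)
    show False
    proof (cases "b = a")
      case True
      then have "E i \<inter> E (i + 1) = insert c (B a)" using 3 g by simp
      then show False using c1 c_notin_B[of a] g card_B[of a] lk by simp
    next
      case False
      then have "B a \<inter> B b = {}" using B_div by blast
      then have "E i \<inter> E (i + 1) = {c}" using 3 g c_notin_B[of a] c_notin_B[of b] by auto
      then show False using c1 l_ge by simp
    qed
  qed
qed

text \<open>Both neighbours of the edge at \<open>c\<close> would contain \<open>Y a\<close>, but
  they are disjoint.\<close>

lemma no_cyc: assumes E: "cyc E" and ci: "c \<in> E i" shows False
proof -
  have H: "E i \<in> H0" using E by (auto simp: cyc_def)
  then obtain a where a: "E i = insert c (B a)" "1 \<le> a" "a < T"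
    using ci dead_not_c by (auto simp: H0_def live_def)
  have 1: "E i \<inter> E (i + 1) = Y a" using no_turn[OF E a] by blast
  have "E i \<inter> E (i - 1) = Y a" using no_turn[OF cyc_rev[OF E], of "- i" a] a by auto
  moreover have "E (i - 1) \<inter> E (i - 1 + 2) = {}" using E unfolding cyc_def by blast
  ultimately have "Y a = {}" using 1 by (auto simp: algebra_simps)
  then show False using card_Y[of a] l_ge by simp
qed

lemma H0_not_hamiltonian: "\<not> hamiltonian n k l H0"
proof
  have n4: "4 * k \<le> n" using s_large c_less by linarith
  assume "hamiltonian n k l H0"
  then obtain E :: "int \<Rightarrow> nat set" where E: "\<And>i. E i \<in> H0" "\<And>i. card (E i \<inter> E (i + 1)) = l" "\<And>i. E i \<inter> E (i + 2) = {}"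
    "\<And>x. x < n \<Longrightarrow> \<exists>i. x \<in> E i"
    using hamiltonian_edge_sequence[OF _ lk n4] by metis
  then have "cyc E" by (simp add: cyc_def)
  moreover obtain i where "c \<in> E i" using E(4)[OF c_less] by blast
  ultimately show False by (rule no_cyc)
qed

section \<open>The members of \<open>H0\<close> as \<open>k\<close>-sets\<close>

lemma live_kset: "live h \<Longrightarrow> h \<subseteq> {0..<n} \<and> card h = k"
  by (simp add: live_def)

lemma dead_kset: assumes "dead a f" shows "f \<subseteq> {0..<n} \<and> card f = k"
proof -
  obtain F where F: "tail_set a F" "f = F \<union> P a" "a \<le> T" "1 \<le> a" using assms by (auto simp: dead_def)
  have 1: "v < c" if "v \<in> F" for v
  proof -
    have "v < s * T" using that F unfolding less_block_iff by (auto simp: tail_set_def intro: order_less_le_trans)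
    then show ?thesis using sT_less by simp
  qed
  have 2: "v < c" if "v \<in> P a" for v using that B_T_less[of v a] P_sub F s_large by fastforce
  have "F \<inter> P a = {}" using tail_P[of a a F] F(1) by auto
  then have "card f = k" using F(1,2) dead_finite[OF F(1)] lk by (simp add: card_Un_disjoint card_P tail_set_def)
  moreover have "f \<subseteq> {0..<n}" using 1 2 c_less F(2) by fastforce
  ultimately show ?thesis by simp
qed

lemma G_kset: assumes "a \<le> T" shows "insert c (B a) \<subseteq> {0..<n} \<and> card (insert c (B a)) = k"
  using c_notin_B[OF assms] B_T_less[OF _ assms] s_large c_less lk by (auto simp: card_B)
    (metis Suc_eq_plus1 less_trans mult_Suc_right add.commute add_lessD1)

lemma kgraph_H0: "kgraph n k H0"
  unfolding kgraph_def
proof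
  fix e assume "e \<in> H0"
  then consider "live e" | a where "dead a e" | a where "e = insert c (B a)" "a \<le> T"
    unfolding H0_def by fastforce
  then show "e \<subseteq> {0..<n} \<and> card e = k" by cases (use live_kset dead_kset G_kset in blast)+
qed

subsection \<open>Narrow sets\<close>

text \<open>Vertices from block \<open>T\<close> on are ignored: in the application their number
  stays bounded, so they contribute only a constant factor to the count.\<close>

definition blocks :: "nat set \<Rightarrow> nat set" where
  "blocks e = (\<lambda>v. v div s) ` {v \<in> e. v < s * T}"
definition ends :: "nat set \<Rightarrow> nat set" where
  "ends e = {b \<in> blocks e. Suc b \<notin> blocks e}"
definition narrow :: "nat set set" where
  "narrow = {e. e \<subseteq> {0..<n} \<and> card e = k \<and> card (ends e) \<le> l}"

lemma finite_blocks: "finite e \<Longrightarrow> finite (blocks e)" and ends_sub: "ends e \<subseteq> blocks e"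
  by (auto simp: blocks_def ends_def)

lemma blocks_less: "b \<in> blocks e \<Longrightarrow> b < T"
  by (auto simp: blocks_def less_block_iff)

lemma ends_subI: "(\<And>v. v \<in> e \<Longrightarrow> v < s * T \<Longrightarrow> v div s \<in> X) \<Longrightarrow> ends e \<subseteq> X"
  by (auto simp: ends_def blocks_def)

lemma card_ends_le: "ends e \<subseteq> X \<Longrightarrow> finite X \<Longrightarrow> card X \<le> l \<Longrightarrow> card (ends e) \<le> l"
  using card_mono le_trans by blast

text \<open>The counted part of a live set lies in an interval of length \<open>D \<le> s\<close>,
  hence in two blocks at most (here \<open>2 \<le> l\<close> enters), or in a single block, or it
  has fewer than \<open>l\<close> vertices.\<close>

lemma live_narrow: assumes "live h" shows "h \<in> narrow"
proof -
  have fh: "finite h" using assms k_pos by (intro card_ge_0_finite) (simp add: live_def)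
  define W where "W = h - Om"
  have inW: "v \<in> W" "v \<notin> P T" if "v \<in> h" "v < s * T" for v
    using that P_div[of v T] less_block_iff[of v T] by (auto simp: W_def Om_def)
  consider (i) x where "W \<subseteq> {x..<x + D}" | (b) b where "b < T" "W \<subseteq> B b"
    | (t) "card (W - P T) < l" | (w) "W \<subseteq> P T"
    using assms unfolding live_def W_def by blast
  then have "card (ends h) \<le> l"
  proof cases
    case i
    have "v div s \<in> {x div s, x div s + 1}" if "v \<in> h" "v < s * T" for v
    proof -
      have v: "x \<le> v" "v < x + D" using subsetD[OF i inW(1)[OF that]] by auto
      have "D \<le> s" using k_pos by (simp add: s_def)
      then have "v div s \<le> (x + s) div s" using v by (intro div_le_mono) linarith
      moreover have "x div s \<le> v div s" using v by (intro div_le_mono)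
      ultimately show ?thesis using s_pos by auto
    qed
    then have "ends h \<subseteq> {x div s, x div s + 1}" by (rule ends_subI)
    then show ?thesis by (rule card_ends_le) (use l_ge in auto)
  next
    case b
    have "v div s \<in> {b}" if "v \<in> h" "v < s * T" for v
      using B_div[OF subsetD[OF b(2) inW(1)[OF that]]] by simp
    then have "ends h \<subseteq> {b}" by (rule ends_subI)
    then show ?thesis by (rule card_ends_le) (use l_ge in auto)
  next
    case t
    have "ends h \<subseteq> (\<lambda>v. v div s) ` (W - P T)" by (rule ends_subI) (use inW in blast)
    moreover have "finite (W - P T)" using fh by (simp add: W_def)
    moreover from this have "card ((\<lambda>v. v div s) ` (W - P T)) \<le> l"
      using t card_image_le[of "W - P T" "\<lambda>v. v div s"] by linarith
    ultimately show ?thesis by (intro card_ends_le[of h "(\<lambda>v. v div s) ` (W - P T)"]) simp_all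
  next
    case w
    then have "ends h \<subseteq> {}" by (intro ends_subI) (use inW in blast)
    then show ?thesis by simp
  qed
  then show ?thesis using assms by (simp add: narrow_def live_def)
qed

lemma dead_narrow: assumes "dead a f" shows "f \<in> narrow"
proof -
  obtain F where F: "tail_set a F" "f = F \<union> P a" "a \<le> T" "1 \<le> a" using assms by (auto simp: dead_def)
  have fF: "finite F" using dead_finite F by blast
  define U where "U = {v \<in> F. v div s \<noteq> a - 1}"
  have cU: "card ((\<lambda>v. v div s) ` U) < l"
    using card_image_le[of U "\<lambda>v. v div s"] fF card_below_top_block[OF F(1), of U] by (simp add: U_def)
  have fU: "finite U" using fF by (simp add: U_def)
  \<comment> \<open>\<open>q\<close> ends the run through block \<open>a - 1\<close>: because of
    \<open>P a\<close> this is block \<open>a\<close>, except that block \<open>T\<close> is not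
    counted.\<close>
  define q where "q = (if a = T then a - 1 else a)"
  have "ends f \<subseteq> insert q ((\<lambda>v. v div s) ` U)"
  proof
    fix b assume b: "b \<in> ends f"
    then obtain v where v: "v \<in> f" "v < s * T" "b = v div s" by (auto simp: ends_def blocks_def)
    show "b \<in> insert q ((\<lambda>v. v div s) ` U)"
    proof (cases "a = T")
      case True
      then have "v \<in> F" using v F P_div by (fastforce simp: less_block_iff)
      then show ?thesis using v True by (auto simp: U_def q_def)
    next
      case False
      obtain p where p: "p \<in> P a" using P_ne by blast
      then have "p div s = a" "p < s * T" using P_div False F by (auto simp: less_block_iff)
      then have "a \<in> blocks f" using p F by (force simp: blocks_def)
      then have "b \<noteq> a - 1" using b F(4) by (auto simp: ends_def)
      then have "b = a \<or> v \<in> U" using v F P_div by (auto simp: U_def)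
      then show ?thesis using v False by (auto simp: q_def)
    qed
  qed
  moreover have "card (insert q ((\<lambda>v. v div s) ` U)) \<le> l"
    using cU fU by (simp add: card_insert_if)
  ultimately have "card (ends f) \<le> l" using fU by (intro card_ends_le) auto
  then show ?thesis using dead_kset[OF assms] by (simp add: narrow_def)
qed

lemma G_narrow: assumes "a < T" shows "insert c (B a) \<in> narrow"
proof -
  have "ends (insert c (B a)) \<subseteq> {a}" by (rule ends_subI) (use sT_less B_div in auto)
  then have "card (ends (insert c (B a))) \<le> l" by (rule card_ends_le) (use l_ge in auto)
  then show ?thesis using G_kset[of a] assms by (simp add: narrow_def)
qed

lemma H0_narrow: "H0 \<subseteq> narrow"
  unfolding H0_def using live_narrow dead_narrow G_narrow by blast

text \<open>Every block of a run holds a vertex of \<open>e\<close>, so a run has at most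
  \<open>k\<close> blocks.\<close>

lemma run_end:
  assumes "finite e" "card e \<le> k" "b \<in> blocks e"
  obtains q where "q \<in> ends e" "b \<le> q" "q < b + k"
proof -
  have fb: "finite (blocks e)" using assms finite_blocks by blast
  define Q where "Q = {q. b \<le> q \<and> {b..q} \<subseteq> blocks e}"
  have "Q \<subseteq> blocks e" by (auto simp: Q_def)
  then have fQ: "finite Q" using fb finite_subset by blast
  moreover have bQ: "b \<in> Q" using assms by (simp add: Q_def)
  ultimately have q: "Max Q \<in> Q" using Max_in by blast
  have "Suc (Max Q) \<notin> Q" using fQ Max_ge Suc_n_not_le_n by blast
  then have "Suc (Max Q) \<notin> blocks e" using q by (auto simp: Q_def atLeastAtMostSuc_conv)
  then have 1: "Max Q \<in> ends e" using q by (auto simp: ends_def Q_def)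
  have "card {b..Max Q} \<le> card (blocks e)" using q fb by (intro card_mono) (auto simp: Q_def)
  also have "\<dots> \<le> card e" unfolding blocks_def using assms(1)
    by (intro card_image_le[THEN le_trans] card_mono) auto
  finally have "Max Q < b + k" using assms by simp
  then show thesis using that 1 q by (auto simp: Q_def)
qed

text \<open>The ends of \<open>e\<close> determine a set \<open>nb\<close> containing
  \<open>e\<close>: everything from \<open>s * T\<close> on and the \<open>k\<close> blocks up to
  each end. There are \<open>n ^ l\<close> lists of ends, and \<open>e\<close> is a subset of
  \<open>nb\<close>.\<close>

lemma card_narrow: "finite narrow" "card narrow \<le> n ^ l * 2 ^ (n - s * T + l * (s * k))"
proof -
  define nb where "nb Q = {s * T..<n} \<union> (\<Union>q\<in>Q. {s * (q + 1 - k)..<s * (q + 1)})" for Q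
  define X where "X = {xs :: nat list. set xs \<subseteq> {0..<n} \<and> length xs = l}"
  have fX: "finite X" unfolding X_def by (rule finite_lists_length_eq) simp
  have fnb: "finite (nb (set xs))" for xs by (simp add: nb_def)
  have sub: "narrow \<subseteq> (\<Union>xs\<in>X. Pow (nb (set xs)))"
  proof
    fix e assume e: "e \<in> narrow"
    then have fe: "finite e" and ek: "card e \<le> k" and el: "card (ends e) \<le> l"
      using finite_subset by (auto simp: narrow_def)
    have fends: "finite (ends e)" using ends_sub finite_blocks[OF fe] finite_subset by blast
    \<comment> \<open>Padding with \<open>0\<close> gives length exactly \<open>l\<close>; an extra
      entry only enlarges \<open>nb\<close>.\<close>
    define xs where "xs = sorted_list_of_set (ends e) @ replicate (l - card (ends e)) 0"
    have "ends e \<subseteq> {0..<n}"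
    proof
      fix b assume "b \<in> ends e"
      then have "b < T" using ends_sub blocks_less by blast
      also have "T \<le> s * T" using s_pos by simp
      also have "\<dots> < n" using sT_less c_less by simp
      finally show "b \<in> {0..<n}" by simp
    qed
    then have "xs \<in> X" using el fends c_less by (auto simp: X_def xs_def)
    moreover have "e \<subseteq> nb (set xs)"
    proof
      fix v assume v: "v \<in> e"
      show "v \<in> nb (set xs)"
      proof (cases "v < s * T")
        case False
        then show ?thesis using e v by (auto simp: nb_def narrow_def)
      next
        case True
        then have "v div s \<in> blocks e" using v by (auto simp: blocks_def)
        then obtain q where q: "q \<in> ends e" "v div s \<le> q" "q < v div s + k"
          using run_end[OF fe ek] by blast
        have "v < s * (q + 1)" unfolding less_block_iff using q by simp
        moreover have "\<not> v < s * (q + 1 - k)" unfolding less_block_iff using q by linarith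
        ultimately show ?thesis using q fends by (auto simp: nb_def xs_def)
      qed
    qed
    ultimately show "e \<in> (\<Union>xs\<in>X. Pow (nb (set xs)))" by blast
  qed
  have fU: "finite (\<Union>xs\<in>X. Pow (nb (set xs)))" using fX fnb by simp
  have "card narrow \<le> card (\<Union>xs\<in>X. Pow (nb (set xs)))" by (rule card_mono[OF fU sub])
  moreover have "finite narrow" by (rule finite_subset[OF sub fU])
  moreover have "card (\<Union>xs\<in>X. Pow (nb (set xs))) \<le> (\<Sum>xs\<in>X. card (Pow (nb (set xs))))"
    using fX by (rule card_UN_le)
  moreover have "\<dots> \<le> (\<Sum>xs\<in>X. 2 ^ (n - s * T + l * (s * k)))"
  proof (rule sum_mono)
    fix xs assume xs: "xs \<in> X"
    have "card (\<Union>q\<in>set xs. {s * (q + 1 - k)..<s * (q + 1)}) \<le> (\<Sum>q\<in>set xs. card {s * (q + 1 - k)..<s * (q + 1)})"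
      by (rule card_UN_le) simp
    also have "\<dots> \<le> (\<Sum>q\<in>set xs. s * k)"
    proof (rule sum_mono)
      fix q
      have "s * (q + 1) - s * (q + 1 - k) = s * (q + 1 - (q + 1 - k))" by (rule diff_mult_distrib2[symmetric])
      also have "\<dots> \<le> s * k" by (intro mult_le_mono2) simp
      finally show "card {s * (q + 1 - k)..<s * (q + 1)} \<le> s * k" by simp
    qed
    also have "\<dots> = card (set xs) * (s * k)" by simp
    also have "\<dots> \<le> l * (s * k)" using xs card_length[of xs] by (intro mult_le_mono1) (auto simp: X_def)
    finally have "card (nb (set xs)) \<le> n - s * T + l * (s * k)"
      unfolding nb_def by (intro card_Un_le[THEN le_trans]) simp
    then show "card (Pow (nb (set xs))) \<le> 2 ^ (n - s * T + l * (s * k))"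
      using fnb by (simp add: card_Pow)
  qed
  moreover have "card X = n ^ l" unfolding X_def by (simp add: card_lists_length_eq)
  ultimately show "finite narrow" "card narrow \<le> n ^ l * 2 ^ (n - s * T + l * (s * k))" by simp_all
qed

subsection \<open>Adding a wide set\<close>

text \<open>The \<open>2 * k\<close> candidates \<open>bp b (k + 2 * i)\<close> lie beyond
  \<open>B b\<close> and are at least \<open>2 * D\<close> apart. Each vertex of \<open>e\<close>
  spoils at most one of them, so at least \<open>k\<close> remain.\<close>

lemma fillers:
  assumes "finite e" "card e \<le> k"
  obtains Q where "card Q = k - 2 * l" "finite Q" "\<And>v. v \<in> Q \<Longrightarrow> v div s = b" "Q \<inter> e = {}" "Q \<inter> B b = {}"
    "\<And>q y x. q \<in> Q \<Longrightarrow> y \<in> Q \<union> e \<Longrightarrow> q \<in> {x..<x + D} \<Longrightarrow> y \<in> {x..<x + D} \<Longrightarrow> y = q"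
proof -
  define g where "g i = bp b (k + 2 * i)" for i
  define bad where "bad = {i \<in> {..<2 * k}. \<exists>y\<in>e. g i < y + D \<and> y < g i + D}"
  have g: "g i + 2 * D \<le> g j" if "i < j" for i j
    using bp_mono[of "k + 2 * i" "k + 2 * i + 1" b] bp_mono[of "k + 2 * i + 1" "k + 2 * j" b] that
    by (simp add: g_def)
  have "card bad \<le> card e" unfolding bad_def by (rule card_near[OF assms(1)]) (rule g)
  then have "k - 2 * l \<le> card ({..<2 * k} - bad)"
    using assms(2) by (subst card_Diff_subset) (auto simp: bad_def)
  then obtain I where I: "I \<subseteq> {..<2 * k} - bad" "card I = k - 2 * l" "finite I"
    by (rule obtain_subset_with_card_n)
  have injg: "inj_on g I" by (auto simp: inj_on_def g_def bp_inj)
  have far: "g i + D \<le> y \<or> y + D \<le> g i" if "i \<in> I" "y \<in> e" for i y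
    using that I(1) by (fastforce simp: bad_def)
  show thesis
  proof (rule that[of "g ` I"])
    show "card (g ` I) = k - 2 * l" using I injg by (simp add: card_image)
    show "finite (g ` I)" using I by simp
    show "v div s = b" if "v \<in> g ` I" for v
      using that I by (auto simp: g_def intro!: bp_div)
    show "g ` I \<inter> e = {}" using far D_pos by force
    show "g ` I \<inter> B b = {}" by (auto simp: g_def B_def bp_inj)
    fix q y x assume q: "q \<in> g ` I" "q \<in> {x..<x + D}" and y: "y \<in> g ` I \<union> e" "y \<in> {x..<x + D}"
    obtain i where i: "i \<in> I" "q = g i" using q by blast
    have "y \<notin> e" using far[OF i(1), of y] q y i by auto
    then obtain j where j: "j \<in> I" "y = g j" using y by blast
    show "y = q" using g[of i j] g[of j i] q y i j by (cases i j rule: linorder_cases) auto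
  qed
qed

text \<open>An interval of length \<open>D\<close> that contains a filler contains no other vertex
  of the tail, so the spread conditions are inherited from \<open>L\<close>. The fillers together
  with \<open>t\<close> give the required \<open>k - 2 * l + 1\<close> vertices in block
  \<open>b\<close>.\<close>

lemma dead_fillers:
  assumes e: "finite e" "card e \<le> k" and L: "L \<subseteq> e" "card L = l" "\<And>v. v \<in> L \<Longrightarrow> v div s \<le> b"
    and t: "t \<in> L" "t div s = b" and bT: "b < T" and LB: "card (L \<inter> B b) < l"
    and LI: "\<And>x. card (L \<inter> {x..<x + D}) < l"
  obtains Q where "card Q = k - 2 * l" "finite Q" "\<And>v. v \<in> Q \<Longrightarrow> v div s = b" "Q \<inter> e = {}"
    "dead (Suc b) (L \<union> Q \<union> P (Suc b))"
proof -
  obtain Q where Q: "card Q = k - 2 * l" "finite Q" "\<And>v. v \<in> Q \<Longrightarrow> v div s = b" "Q \<inter> e = {}" "Q \<inter> B b = {}"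
    and iso: "\<And>q y x. q \<in> Q \<Longrightarrow> y \<in> Q \<union> e \<Longrightarrow> q \<in> {x..<x + D} \<Longrightarrow> y \<in> {x..<x + D} \<Longrightarrow> y = q"
    using fillers[OF e, of b] by metis
  have fL: "finite L" using e L finite_subset by blast
  have LQ: "L \<inter> Q = {}" using L Q by blast
  have "tail_set (Suc b) (L \<union> Q)"
    unfolding tail_set_def
  proof (intro conjI ballI allI)
    show "v div s < Suc b" if "v \<in> L \<union> Q" for v using that L(3) Q(3) by (auto simp: less_Suc_eq_le)
    show "card (L \<union> Q) = k - l" using fL Q LQ L lk by (simp add: card_Un_disjoint)
    have "card (insert t Q) \<le> card {v \<in> L \<union> Q. v div s = Suc b - 1}"
      using fL Q t by (intro card_mono) auto
    moreover have "t \<notin> Q" using t LQ by blast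
    ultimately show "k - 2 * l + 1 \<le> card {v \<in> L \<union> Q. v div s = Suc b - 1}" using Q by simp
    have "(L \<union> Q) \<inter> B (Suc b - 1) = L \<inter> B b" using Q(5) by auto
    then show "card ((L \<union> Q) \<inter> B (Suc b - 1)) < l" using LB by simp
    fix x
    show "card ((L \<union> Q) \<inter> {x..<x + D}) < l"
    proof (cases "Q \<inter> {x..<x + D} = {}")
      case True
      then have "(L \<union> Q) \<inter> {x..<x + D} = L \<inter> {x..<x + D}" by blast
      then show ?thesis using LI by simp
    next
      case False
      then obtain q where "q \<in> Q" "q \<in> {x..<x + D}" by blast
      then have "(L \<union> Q) \<inter> {x..<x + D} \<subseteq> {q}" using iso[of q] L(1) by blast
      then have "card ((L \<union> Q) \<inter> {x..<x + D}) \<le> card {q}" by (intro card_mono) auto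
      then show ?thesis using l_ge by simp
    qed
  qed
  then have "dead (Suc b) (L \<union> Q \<union> P (Suc b))" using bT unfolding dead_def by (intro conjI exI[of _ "L \<union> Q"]) auto
  then show thesis using that Q by blast
qed

section \<open>From the new edge to the reservoir\<close>

lemma S0_Om: "S0 \<subseteq> Om"
proof
  fix v assume v: "v \<in> S0"
  then have "s * (T + 1) \<le> v" "v < c" by (auto simp: S0_def)
  moreover have "v \<notin> P T" using B_T_less[of v T] P_sub[of T] calculation by auto
  ultimately show "v \<in> Om" by (auto simp: Om_def algebra_simps)
qed

lemma live_window:
  assumes "distinct w" "length w = k" "set w \<subseteq> {0..<c}"
    "(\<exists>x. set w - Om \<subseteq> {x..<x + D}) \<or>
      (\<exists>a<T. set w - Om \<subseteq> B a \<and> (card (set w - Om) = l \<longrightarrow> set w - Om = Y a)) \<or>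
      P T \<subseteq> set w \<and> card (set w - Om - P T) < l \<or> set w - Om \<subseteq> P T"
  shows "set w \<in> H0"
proof -
  have "set w \<subseteq> {0..<n}" "c \<notin> set w" using assms(3) c_less by auto
  moreover have "card (set w) = k" using distinct_card[OF assms(1)] assms(2) by simp
  ultimately have "live (set w)" unfolding live_def by (intro conjI assms(4))
  then show ?thesis by (simp add: H0_def)
qed

text \<open>\<open>u\<close> leads from the last \<open>l\<close> vertices \<open>R\<close> of the new edge \<open>e\<close> to the reservoir \<open>S0\<close>.\<close>

definition leads :: "nat set \<Rightarrow> nat set \<Rightarrow> nat list \<Rightarrow> bool" where
  "leads e R u \<longleftrightarrow> distinct u \<and> set u \<inter> e = {} \<and> set u \<subseteq> {0..<s * (T + 1)} \<and> length u + l \<le> 2 * (k - l) \<and>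
     (\<forall>r X. set r = R \<longrightarrow> distinct r \<longrightarrow> distinct X \<longrightarrow> set X \<subseteq> S0 \<longrightarrow> set X \<inter> e = {} \<longrightarrow> 2 * k \<le> length X \<longrightarrow>
        set (take k (r @ u @ X)) \<in> H0 \<and> set (take k (drop (k - l) (r @ u @ X))) \<in> H0)"

text \<open>The second window starts past \<open>R\<close> and the first \<open>k - 2 * l\<close>
  entries of \<open>u\<close>; reservoir vertices complete both windows.\<close>

lemma leadsI:
  assumes e: "e \<subseteq> {0..<n}" "R \<subseteq> e" "card R = l" "c \<notin> R"
    and u: "distinct u" "set u \<inter> e = {}" "set u \<subseteq> {0..<s * (T + 1)}" "length u + l \<le> 2 * (k - l)"
    and w: "\<And>w X. distinct w \<Longrightarrow> length w = k \<Longrightarrow> set w \<subseteq> {0..<c} \<Longrightarrow> X \<subseteq> S0 \<Longrightarrow>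
       set w = R \<union> set (take (k - l) u) \<union> X \<Longrightarrow> set w \<in> H0"
     "\<And>w X. distinct w \<Longrightarrow> length w = k \<Longrightarrow> set w \<subseteq> {0..<c} \<Longrightarrow> X \<subseteq> S0 \<Longrightarrow>
       set w = set (drop (k - 2 * l) u) \<union> X \<Longrightarrow> set w \<in> H0"
  shows "leads e R u"
  unfolding leads_def
proof (intro conjI u allI impI)
  fix r X assume r: "set r = R" "distinct r" and X: "distinct X" "set X \<subseteq> S0" "set X \<inter> e = {}" "2 * k \<le> length X"
  have lr: "length r = l" using r e distinct_card[of r] by simp
  have "v < c" if "v \<in> set (r @ u @ X)" for v
  proof -
    consider "v \<in> R" | "v \<in> set u" | "v \<in> S0" using \<open>v \<in> _\<close> r X(2) by auto
    then show ?thesis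
    proof cases
      case 1
      then have "v < n" "v \<noteq> c" using e by auto
      then show ?thesis by (simp add: c_def)
    next
      case 2
      then have "v < s * (T + 1)" using u(3) by (simp add: subset_iff)
      then show ?thesis using s_large by linarith
    qed (simp add: S0_def)
  qed
  then have low: "set (r @ u @ X) \<subseteq> {0..<c}" by auto
  have "set X \<inter> {0..<s * (T + 1)} = {}" using X(2) by (auto simp: S0_def)
  then have dis: "distinct (r @ u @ X)" using r X u e by auto
  have len: "k + (k - l) \<le> length (r @ u @ X)" using X by simp
  show "set (take k (r @ u @ X)) \<in> H0"
  proof (rule w(1))
    show "set (take k (r @ u @ X)) = R \<union> set (take (k - l) u) \<union> set (take (k - l - length u) X)"
      using r lr lk by (simp add: Un_assoc)
    show "set (take k (r @ u @ X)) \<subseteq> {0..<c}" by (rule subset_trans[OF set_take_subset low])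
    show "set (take (k - l - length u) X) \<subseteq> S0" by (rule subset_trans[OF set_take_subset X(2)])
    show "distinct (take k (r @ u @ X))" by (rule distinct_take[OF dis])
    have "length (take k (r @ u @ X)) = min (length (r @ u @ X)) k" by (rule length_take)
    then show "length (take k (r @ u @ X)) = k" using len by linarith
  qed
  show "set (take k (drop (k - l) (r @ u @ X))) \<in> H0"
  proof (rule w(2))
    have "length (drop (k - 2 * l) u) \<le> k" using u(4) lk by simp
    then show "set (take k (drop (k - l) (r @ u @ X))) = set (drop (k - 2 * l) u) \<union>
      set (take (k - length (drop (k - 2 * l) u)) (drop (k - 2 * l - length u) X))"
      using lr lk by (simp add: mult_2)
    show "set (take k (drop (k - l) (r @ u @ X))) \<subseteq> {0..<c}"
      by (rule subset_trans[OF set_take_subset subset_trans[OF set_drop_subset low]])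
    show "set (take (k - length (drop (k - 2 * l) u)) (drop (k - 2 * l - length u) X)) \<subseteq> S0"
      by (rule subset_trans[OF set_take_subset subset_trans[OF set_drop_subset X(2)]])
    have "length (take k (drop (k - l) (r @ u @ X))) = min (length (r @ u @ X) - (k - l)) k"
      by (simp only: length_take length_drop)
    then show "length (take k (drop (k - l) (r @ u @ X))) = k" using len by linarith
    show "distinct (take k (drop (k - l) (r @ u @ X)))" by (rule distinct_take[OF distinct_drop[OF dis]])
  qed
qed

lemma below_sT_if_outside: assumes "v < n" "v \<noteq> c" "v \<notin> Om \<union> P T" shows "v < s * T"
  using assms by (auto simp: Om_def c_def)

text \<open>If no choice of \<open>u\<close> makes the first edge after \<open>e\<close> live, it is
  a dead edge of block \<open>b + 1\<close>, left through \<open>P (b + 1)\<close>. Keeping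
  \<open>u\<close> in blocks from \<open>b\<close> on separates it from the part that closes the
  cycle at a lower block.\<close>

lemma continuation:
  assumes e: "e \<subseteq> {0..<n}" "card e = k" and L: "L \<subseteq> e" "card L = l" "\<And>v. v \<in> L \<Longrightarrow> v < s * T \<and> v div s < b"
    and t: "t \<in> e" "t < s * T" "t div s = b" and top: "\<And>v. v \<in> e \<Longrightarrow> v < s * T \<Longrightarrow> v div s \<le> b"
  obtains R u where "R \<subseteq> e - L" "card R = l" "leads e R u" "\<forall>v\<in>set u. b \<le> v div s"
proof -
  have fe: "finite e" using e finite_subset by blast
  have bT: "b < T" using t by (simp add: less_block_iff)
  \<comment> \<open>Neither live nor dead sets contain \<open>c\<close>, so \<open>R\<close> has to
    avoid it; \<open>k - l - 1 \<ge> l\<close> vertices are still available.\<close>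
  define E' where "E' = e - L - {c}"
  have fE: "finite E'" using fe by (simp add: E'_def)
  have "card (e - L) = k - l" using fe e L finite_subset[OF L(1) fe] by (simp add: card_Diff_subset)
  then have cE: "l \<le> card E'" using fe lk by (auto simp: E'_def card_Diff_singleton_if)
  have lowP: "v < s * (T + 1)" "v div s = T" if "v \<in> P T" for v
    using that B_T_less[of v T] P_sub P_div by auto
  show thesis
  proof (cases "e \<inter> (Om \<union> P T) = {}")
    case False
    have not_L: "L \<inter> (Om \<union> P T) = {}"
    proof -
      have False if "v \<in> L" "v \<in> Om \<union> P T" for v
      proof -
        have "v < s * T" using L(3) that by blast
        then show False using that(2) P_div[of v T] less_block_iff[of v T] by (auto simp: Om_def)
      qed
      then show ?thesis by blast
    qed
    have not_c: "c \<notin> Om \<union> P T" using c_notin_B[of T] P_sub[of T] by (auto simp: Om_def)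
    \<comment> \<open>With all of \<open>e \<inter> P T\<close> in \<open>R\<close>, the list
      \<open>u\<close> can complete \<open>P T\<close> without touching \<open>e\<close>. As
      \<open>Z\<close> is nonempty, fewer than \<open>l\<close> vertices of \<open>R\<close> lie
      outside \<open>Om \<union> P T\<close>.\<close>
    define Z where "Z = (if e \<inter> P T = {} then {SOME w. w \<in> e \<inter> Om} else e \<inter> P T)"
    have "\<exists>w. w \<in> e \<inter> Om" if "e \<inter> P T = {}" using False that by blast
    then have Z: "Z \<subseteq> e \<inter> (Om \<union> P T)" "e \<inter> P T \<subseteq> Z" "Z \<noteq> {}"
      unfolding Z_def using someI_ex[of "\<lambda>w. w \<in> e \<inter> Om"] by auto
    have "card Z \<le> l"
    proof (cases "e \<inter> P T = {}")
      case True then show ?thesis using l_ge by (simp add: Z_def)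
    next
      case False
      have "card (e \<inter> P T) \<le> card (P T)" by (intro card_mono) auto
      then show ?thesis using False by (simp add: Z_def card_P)
    qed
    moreover have "Z \<subseteq> E'" using Z(1) not_L not_c by (auto simp: E'_def)
    ultimately obtain R where R: "Z \<subseteq> R" "R \<subseteq> E'" "card R = l"
      using exists_subset_between[OF _ cE _ fE] by metis
    have PR: "P T - R = P T - e" using R(1,2) Z(2) by (auto simp: E'_def)
    define u where "u = sorted_list_of_set (P T - R)"
    have u: "set u = P T - R" "distinct u" by (auto simp: u_def)
    have lu: "length u \<le> l" using card_mono[of "P T" "P T - R"] by (simp add: u_def card_P)
    have fR: "finite R" using R fE finite_subset by blast
    have lR: "card (R - Om - P T) < l"
    proof -
      have "R - Om - P T \<subset> R" using Z(1,3) R(1) by blast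
      then show ?thesis using fR psubset_card_mono R(3) by metis
    qed
    have "leads e R u"
    proof (rule leadsI[OF e(1)])
      show "R \<subseteq> e" "c \<notin> R" "card R = l" using R by (auto simp: E'_def)
      show "distinct u" by (rule u)
      show "set u \<inter> e = {}" using u PR by blast
      show "set u \<subseteq> {0..<s * (T + 1)}" using u lowP by auto
      show "length u + l \<le> 2 * (k - l)" using lu lk by linarith
      fix w X assume w: "distinct w" "length w = k" "set w \<subseteq> {0..<c}" and X: "X \<subseteq> S0"
      {
        assume sw: "set w = R \<union> set (take (k - l) u) \<union> X"
        have "take (k - l) u = u" using lu lk by simp
        then have sw': "set w = R \<union> P T \<union> X" using sw u by auto
        have "set w - Om - P T \<subseteq> R - Om - P T" using sw' X S0_Om by blast
        then have "card (set w - Om - P T) \<le> card (R - Om - P T)" using fR by (intro card_mono) auto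
        then show "set w \<in> H0" using lR sw' by (intro live_window[OF w]) auto
      next
        assume sw: "set w = set (drop (k - 2 * l) u) \<union> X"
        have "set w - Om \<subseteq> P T" using sw X S0_Om u(1) set_drop_subset[of "k - 2 * l" u] by blast
        then show "set w \<in> H0" by (intro live_window[OF w]) blast
      }
    qed
    moreover have "b \<le> v div s" if "v \<in> set u" for v using that u lowP bT by auto
    moreover have "R \<subseteq> e - L" using R by (auto simp: E'_def)
    ultimately show thesis using that R by blast
  next
    case True
    have "t \<notin> L" using L(3)[of t] t by auto
    moreover have "t \<noteq> c" using t sT_less by auto
    ultimately have "{t} \<subseteq> E'" using t by (simp add: E'_def)
    then obtain R where R: "t \<in> R" "R \<subseteq> E'" "card R = l"
      using exists_subset_between[of "{t}" l E'] cE fE l_ge by auto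
    have ReL: "R \<subseteq> e - L" "R \<subseteq> e" "c \<notin> R" using R by (auto simp: E'_def)
    have fR: "finite R" using R fE finite_subset by blast
    have low: "v < s * T" if "v \<in> R" for v
    proof -
      have "v \<in> e" "v \<noteq> c" using that ReL by auto
      moreover from this have "v < n" "v \<notin> Om \<union> P T" using True subsetD[OF e(1)] by auto
      ultimately show ?thesis using below_sT_if_outside by blast
    qed
    then have Rb: "v div s \<le> b" if "v \<in> R" for v using that top ReL by blast
    have XOm: "X - Om = {}" if "X \<subseteq> S0" for X using that S0_Om by blast
    consider (i) x where "R \<subseteq> {x..<x + D}" | (B) "R \<subseteq> B b"
      | (d) "\<And>x. \<not> R \<subseteq> {x..<x + D}" "\<not> R \<subseteq> B b" by blast
    then show thesis
    proof cases
      case i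
      have "leads e R []"
      proof (rule leadsI[OF e(1)])
        fix w X assume w: "distinct w" "length w = k" "set w \<subseteq> {0..<c}" and X: "X \<subseteq> S0"
        {
          assume "set w = R \<union> set (take (k - l) []) \<union> X"
          then have "set w - Om \<subseteq> {x..<x + D}" using i XOm[OF X] by auto
          then show "set w \<in> H0" by (intro live_window[OF w]) blast
        next
          assume "set w = set (drop (k - 2 * l) []) \<union> X"
          then have "set w - Om \<subseteq> P T" using XOm[OF X] by auto
          then show "set w \<in> H0" by (intro live_window[OF w]) blast
        }
      qed (use ReL R lk in auto)
      then show thesis using that[of R "[]"] R ReL by simp
    next
      case B
      \<comment> \<open>By counting, \<open>e\<close> misses some vertex \<open>m\<close> of
        \<open>B b\<close>. Adding \<open>m\<close> to \<open>R\<close> gives \<open>l + 1\<close>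
        vertices and so avoids the exceptional size \<open>l\<close> in \<open>live\<close>.\<close>
      have "card (e \<inter> B b) \<le> card (e - L)"
        using L(3) B_div fe by (intro card_mono) fastforce+
      also have "\<dots> < card (B b)" using \<open>card (e - L) = k - l\<close> card_B[of b] l_ge lk by simp
      finally have "\<not> B b \<subseteq> e" by (metis Int_absorb1 less_irrefl)
      then obtain m where m: "m \<in> B b" "m \<notin> e" by blast
      have mb: "m div s = b" using m B_div by blast
      have "leads e R [m]"
      proof (rule leadsI[OF e(1)])
        have "m < s * (T + 1)" using B_T_less m bT by simp
        then show "set [m] \<subseteq> {0..<s * (T + 1)}" by simp
        fix w X assume w: "distinct w" "length w = k" "set w \<subseteq> {0..<c}" and X: "X \<subseteq> S0"
        {
          assume sw: "set w = R \<union> set (take (k - l) [m]) \<union> X"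
          obtain q where "k - l = Suc q" using lk by (cases "k - l") auto
          then have sw': "set w - Om = insert m R" using sw XOm[OF X] B m B_Om[OF bT] by auto
          moreover have "m \<notin> R" using m ReL by blast
          ultimately have "card (set w - Om) = Suc l" using fR R by simp
          then show "set w \<in> H0" using bT sw' B m by (intro live_window[OF w]) auto
        next
          assume sw: "set w = set (drop (k - 2 * l) [m]) \<union> X"
          obtain q where "k - 2 * l = Suc q" using lk by (cases "k - 2 * l") auto
          then have "set w - Om \<subseteq> P T" using sw XOm[OF X] by auto
          then show "set w \<in> H0" by (intro live_window[OF w]) blast
        }
      qed (use ReL R m lk l_ge in auto)
      then show thesis using that[of R "[m]"] R ReL mb by simp
    next
      case d
      have "card (R \<inter> B b) < l"
        using psubset_card_mono[of R "R \<inter> B b"] fR d(2) R(3) by blast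
      moreover have "card (R \<inter> {x..<x + D}) < l" for x
        using psubset_card_mono[of R "R \<inter> {x..<x + D}"] fR d(1)[of x] R(3) by blast
      ultimately obtain Q where Q: "card Q = k - 2 * l" "finite Q" "\<And>v. v \<in> Q \<Longrightarrow> v div s = b" "Q \<inter> e = {}"
        and dd: "dead (Suc b) (R \<union> Q \<union> P (Suc b))"
        using dead_fillers[OF fe _ ReL(2) R(3) Rb R(1) t(3) bT] e by (metis order_refl)
      \<comment> \<open>\<open>P (Suc b)\<close> alone would have the exceptional size
        \<open>l\<close> without being \<open>Y (Suc b)\<close>; \<open>g\<close> raises it to
        \<open>l + 1\<close>.\<close>
      define g where "g = bp (Suc b) l"
      have "l < k - 1" using lk l_ge by linarith
      then have "g \<in> B (Suc b)" unfolding g_def B_def by blast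
      moreover have "g \<notin> P (Suc b)" by (auto simp: g_def P_def bp_inj)
      ultimately have gB: "g \<in> B (Suc b)" "g \<notin> P (Suc b)" .
      define u where "u = sorted_list_of_set Q @ sorted_list_of_set (P (Suc b)) @ [g]"
      have su: "set u = Q \<union> P (Suc b) \<union> {g}" using Q by (simp add: u_def)
      have lu: "length u = k - l + 1" using Q lk by (simp add: u_def card_P)
      have PB: "insert g (P (Suc b)) \<subseteq> B (Suc b)" using gB P_sub by simp
      have Be: "insert g (P (Suc b)) \<inter> e = {}"
      proof -
        have False if v: "v \<in> insert g (P (Suc b))" "v \<in> e" for v
        proof -
          have vd: "v div s = Suc b" using v PB B_div by blast
          have "v \<noteq> c" using v PB c_notin_B[of "Suc b"] bT by auto
          moreover have "v < n" using v e by auto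
          ultimately have "v < s * T" using below_sT_if_outside[of v] v True by blast
          then show False using top[OF v(2)] vd by simp
        qed
        then show ?thesis by blast
      qed
      have "leads e R u"
      proof (rule leadsI[OF e(1)])
        have "Q \<inter> insert g (P (Suc b)) = {}" using Q(3) PB B_div by (metis disjoint_iff n_not_Suc_n subsetD)
        then show "distinct u" unfolding u_def using Q(2) gB(2) by auto
        show "set u \<inter> e = {}" using su Q(4) Be by blast
        show "set u \<subseteq> {0..<s * (T + 1)}"
        proof -
          have "v < s * (T + 1)" if "v \<in> set u" for v
          proof -
            have "v div s \<le> Suc b" using that su Q(3) PB B_div by fastforce
            then show ?thesis unfolding less_block_iff using bT by simp
          qed
          then show ?thesis by auto
        qed
        show "length u + l \<le> 2 * (k - l)" using lu lk by simp
        fix w X assume w: "distinct w" "length w = k" "set w \<subseteq> {0..<c}" and X: "X \<subseteq> S0"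
        {
          assume sw: "set w = R \<union> set (take (k - l) u) \<union> X"
          have "take (k - l) u = sorted_list_of_set Q @ sorted_list_of_set (P (Suc b))"
            using Q lk by (simp add: u_def card_P)
          then have sub: "R \<union> Q \<union> P (Suc b) \<subseteq> set w" using sw Q by auto
          have "card (set w) = card (R \<union> Q \<union> P (Suc b))"
            using dead_kset[OF dd] distinct_card[OF w(1)] w(2) by simp
          then have "R \<union> Q \<union> P (Suc b) = set w" using card_subset_eq[OF _ sub] by simp
          then show "set w \<in> H0" using dd by (auto simp: H0_def)
        next
          assume sw: "set w = set (drop (k - 2 * l) u) \<union> X"
          have "drop (k - 2 * l) u = sorted_list_of_set (P (Suc b)) @ [g]"
            using Q by (simp add: u_def)
          then have sw': "set w = insert g (P (Suc b)) \<union> X" using sw by auto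
          show "set w \<in> H0"
          \<comment> \<open>In block \<open>T\<close> the vertex \<open>g\<close> belongs to
            \<open>Om\<close>, and the clause for sets containing \<open>P T\<close>
            applies.\<close>
          proof (cases "Suc b = T")
            case True
            have "g < c" using w(3) sw' by auto
            moreover have "s * T \<le> g" using gB(1) B_div[of g T] less_block_iff[of g T] True by auto
            ultimately have "g \<in> Om" using gB True by (simp add: Om_def)
            then have "set w - Om - P T = {}" using sw' XOm[OF X] True by auto
            then show ?thesis using sw' True l_ge by (intro live_window[OF w]) auto
          next
            case False
            then have bT': "Suc b < T" using bT by simp
            then have sw'': "set w - Om = insert g (P (Suc b))" using sw' XOm[OF X] B_Om[of "Suc b"] PB by blast
            then have "card (set w - Om) = Suc l" using gB by (simp add: card_P)
            then show ?thesis using sw'' PB bT' by (intro live_window[OF w]) auto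
          qed
        }
      qed (use ReL R in auto)
      moreover have "b \<le> v div s" if "v \<in> set u" for v using that su Q(3) PB B_div by fastforce
      ultimately show thesis using that[of R u] R ReL by blast
    qed
  qed
qed

text \<open>The block after an end is not met by \<open>e\<close>, so the blocks chosen for
  \<open>L\<close> are pairwise non-consecutive, and an interval of length \<open>D \<le> s\<close>
  contains at most one vertex of \<open>L\<close>.\<close>

lemma spread_set:
  assumes e: "e \<subseteq> {0..<n}" "card e = k" and wide: "l < card (ends e)"
  obtains b a L Q t where "t \<in> e" "t < s * T" "t div s = b" "\<And>v. v \<in> e \<Longrightarrow> v < s * T \<Longrightarrow> v div s \<le> b"
    "a < b" "\<And>v. v \<in> e \<Longrightarrow> v div s \<noteq> a" "1 \<le> a"
    "L \<subseteq> e" "card L = l" "\<And>v. v \<in> L \<Longrightarrow> v < s * T \<and> v div s < b"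
    "card Q = k - 2 * l" "finite Q" "\<And>v. v \<in> Q \<Longrightarrow> v div s = a - 1" "Q \<inter> e = {}" "dead a (L \<union> Q \<union> P a)"
proof -
  have fe: "finite e" using e finite_subset by blast
  have fb: "finite (blocks e)" using finite_blocks[OF fe] .
  have fends: "finite (ends e)" using ends_sub fb finite_subset by blast
  have "ends e \<noteq> {}" using wide by auto
  then have ne: "blocks e \<noteq> {}" using ends_sub by auto
  define b where "b = Max (blocks e)"
  have b: "b \<in> blocks e" using fb ne by (simp add: b_def)
  have top: "v div s \<le> b" if "v \<in> e" "v < s * T" for v
    unfolding b_def using that fb by (intro Max_ge) (auto simp: blocks_def)
  obtain t where t: "t \<in> e" "t < s * T" "t div s = b" using b by (auto simp: blocks_def)
  \<comment> \<open>Block \<open>b\<close> ends the topmost run and is set aside for the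
    continuation.\<close>
  have "l \<le> card (ends e - {b})" using wide by (auto simp: card_Diff_singleton_if)
  then obtain J where J: "J \<subseteq> ends e - {b}" "card J = l" "finite J" by (rule obtain_subset_with_card_n)
  have "\<exists>v. v \<in> e \<and> v < s * T \<and> v div s = j" if "j \<in> J" for j
    using that J ends_sub by (fastforce simp: blocks_def)
  then obtain f where f: "\<And>j. j \<in> J \<Longrightarrow> f j \<in> e \<and> f j < s * T \<and> f j div s = j" by metis
  define L where "L = f ` J"
  have injf: "inj_on f J" using f by (metis inj_onI)
  have L: "L \<subseteq> e" "card L = l" using f J injf by (auto simp: L_def card_image)
  have Ld: "v div s \<in> J" "v < s * T" if "v \<in> L" for v using that f by (auto simp: L_def)
  have Jb: "j < b" if "j \<in> J" for j
  proof -
    have "j \<in> blocks e" "j \<noteq> b" using that J ends_sub by auto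
    then show ?thesis using fb by (simp add: b_def order_less_le)
  qed
  define q where "q = Max J"
  have Jne: "J \<noteq> {}" using J l_ge by auto
  have q: "q \<in> J" using J Jne by (simp add: q_def)
  have qn: "Suc q \<notin> blocks e" using q J by (auto simp: ends_def)
  have qb: "Suc q < b" using Jb[OF q] qn b by (metis Suc_lessI)
  have bT: "b < T" using b blocks_less by blast
  have Lq: "v div s \<le> q" if "v \<in> L" for v using Ld[OF that] J by (simp add: q_def)
  have uniq: "v = v'" if "v \<in> L" "v' \<in> L" "v div s = v' div s" for v v' using that f by (auto simp: L_def)
  have "card (L \<inter> B q) \<le> 1"
    using uniq B_div by (fastforce simp: card_le_Suc0_iff_eq)
  then have LB: "card (L \<inter> B q) < l" using l_ge by linarith
  have LI: "card (L \<inter> {x..<x + D}) < l" for x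
  proof -
    have "v = v'" if v: "v \<in> L \<inter> {x..<x + D}" "v' \<in> L \<inter> {x..<x + D}" "v div s \<le> v' div s" for v v'
    proof (cases "v div s = v' div s")
      case False
      then have less: "v div s < v' div s" using v by simp
      have "v div s \<in> J" "v' div s \<in> J" using Ld v by auto
      then have "Suc (v div s) \<notin> blocks e" "v' div s \<in> blocks e" using J ends_sub by (auto simp: ends_def)
      then have "Suc (Suc (v div s)) \<le> v' div s" using less by (metis Suc_leI le_neq_implies_less)
      moreover have "D \<le> s" using k_pos by (simp add: s_def)
      then have "v' div s \<le> (v + s) div s" using v by (intro div_le_mono) auto
      ultimately show ?thesis using s_pos by simp
    qed (use v uniq in blast)
    then have "\<forall>v\<in>L \<inter> {x..<x + D}. \<forall>v'\<in>L \<inter> {x..<x + D}. v = v'" by (metis nat_le_linear)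
    then have "card (L \<inter> {x..<x + D}) \<le> 1" by (simp add: card_le_Suc0_iff_eq)
    then show ?thesis using l_ge by linarith
  qed
  obtain Q where Q: "card Q = k - 2 * l" "finite Q" "\<And>v. v \<in> Q \<Longrightarrow> v div s = q" "Q \<inter> e = {}"
    "dead (Suc q) (L \<union> Q \<union> P (Suc q))"
    using dead_fillers[OF fe _ L Lq _ _ _ LB LI, of "f q"] f[OF q] q qb bT e
    by (metis L_def Suc_lessD imageI less_trans order_refl)
  show thesis
  proof (rule that[OF t top qb, of L Q])
    show "v div s \<noteq> Suc q" if "v \<in> e" for v
    proof
      assume v: "v div s = Suc q"
      then have "v < s * T" unfolding less_block_iff using qb bT by simp
      then have "v div s \<in> blocks e" unfolding blocks_def using that by blast
      then show False using v qn by simp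
    qed
    show "v < s * T \<and> v div s < b" if "v \<in> L" for v using Ld[OF that] Jb by blast
    show "L \<subseteq> e" "card L = l" by (rule L)+
  qed (use Q in auto)
qed

text \<open>The cycle runs through \<open>L\<close>, \<open>e - L - R\<close>, \<open>R\<close>,
  \<open>u\<close>, reservoir vertices, the remaining low vertices in increasing order, reservoir
  vertices again, \<open>Y a\<close>, \<open>c\<close> with the rest of \<open>B a\<close>,
  \<open>P a\<close> and \<open>Q\<close>, and returns to \<open>L\<close> by a dead edge.\<close>

lemma wide_hamiltonian:
  assumes dvd: "(k - l) dvd n" and e: "e \<subseteq> {0..<n}" "card e = k" and wide: "l < card (ends e)"
  shows "hamiltonian n k l (insert e H0)"
proof -
  obtain b a L Q t where t: "t \<in> e" "t < s * T" "t div s = b" "\<And>v. v \<in> e \<Longrightarrow> v < s * T \<Longrightarrow> v div s \<le> b"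
    and a: "a < b" "\<And>v. v \<in> e \<Longrightarrow> v div s \<noteq> a" "1 \<le> a"
    and L: "L \<subseteq> e" "card L = l" "\<And>v. v \<in> L \<Longrightarrow> v < s * T \<and> v div s < b"
    and Q: "card Q = k - 2 * l" "finite Q" "\<And>v. v \<in> Q \<Longrightarrow> v div s = a - 1" "Q \<inter> e = {}"
      "dead a (L \<union> Q \<union> P a)"
    by (rule spread_set[OF e wide], rule that)
  obtain R u where R: "R \<subseteq> e - L" "card R = l" and u: "leads e R u" "\<forall>v\<in>set u. b \<le> v div s"
    by (rule continuation[OF e L t]) blast+
  have fe: "finite e" using e finite_subset by blast
  have fL: "finite L" and fR: "finite R" using L R fe finite_subset by blast+
  have bT: "b < T" using t by (simp add: less_block_iff)
  define N where "N = s * (T + 1)"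
  have N: "N + 6 * k < c" using s_large by (simp add: N_def)
  have lessN: "v < N \<longleftrightarrow> v div s < T + 1" for v unfolding N_def by (rule less_block_iff)
  have uN: "set u \<subseteq> {0..<N}" and ue: "set u \<inter> e = {}" and du: "distinct u" and lu: "length u + l \<le> 2 * (k - l)"
    using u(1) by (auto simp: leads_def N_def)
  have S0N: "S0 = {N..<c}" by (simp add: S0_def N_def)
  have BN: "B a \<subseteq> {0..<N}" and QN: "Q \<subseteq> {0..<N}"
    using B_div Q(3) a bT by (auto simp: lessN)
  have Be: "B a \<inter> e = {}" using B_div a(2) by blast
  have Bu: "B a \<inter> set u = {}" and Qu: "Q \<inter> set u = {}" and QB: "Q \<inter> B a = {}"
    using B_div Q(3) u(2) a by fastforce+
  \<comment> \<open>If \<open>e\<close> already contains \<open>c\<close>, a reservoir vertex takes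
    its place next to \<open>B a\<close>; that edge is then live because
    \<open>k - 1 \<noteq> l\<close>.\<close>
  define c' where "c' = (if c \<in> e then SOME x. x \<in> S0 - e else c)"
  have "card e < card S0" using N e by (simp add: S0N)
  then have "\<not> S0 \<subseteq> e" using card_mono[OF fe] by (meson leD)
  then have "\<exists>x. x \<in> S0 - e" by blast
  then have c'e: "c' \<notin> e" and c'S: "c' = c \<or> c' \<in> S0" and c'c: "c \<in> e \<Longrightarrow> c' \<in> S0" "c \<notin> e \<Longrightarrow> c' = c"
    unfolding c'_def using someI_ex[of "\<lambda>x. x \<in> S0 - e"] by (auto split: if_splits)
  have c'N: "N \<le> c'" "c' < n" using c'S N c_less by (auto simp: S0N)
  define Xs where "Xs = sorted_list_of_set (S0 - e - {c'})"
  \<comment> \<open>At least \<open>2 * k\<close> reservoir vertices on either side of the sweep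
    keep the two windows of \<open>leads\<close> off \<open>rest\<close> and prevent a window from
    meeting both \<open>rest\<close> and \<open>Yl\<close>.\<close>
  define X1 where "X1 = drop (2 * k) Xs"
  define X2 where "X2 = take (2 * k) Xs"
  have setXs: "set Xs = S0 - e - {c'}" by (simp add: Xs_def)
  have setX: "set X1 \<union> set X2 = S0 - e - {c'}"
    unfolding setXs[symmetric] X1_def X2_def by (metis append_take_drop_id set_append sup_commute)
  have "distinct (X2 @ X1)" by (simp add: X1_def X2_def Xs_def)
  then have dX: "distinct X1" "distinct X2" "set X1 \<inter> set X2 = {}" by auto
  have "card S0 - card (e \<union> {c'}) \<le> card (S0 - (e \<union> {c'}))" using fe by (intro diff_card_le_card_Diff) simp
  moreover have "card (e \<union> {c'}) \<le> k + 1" using fe e by (simp add: card_insert_if)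
  moreover have "S0 - (e \<union> {c'}) = S0 - e - {c'}" by blast
  ultimately have "4 * k \<le> length Xs" using N k_pos by (simp add: Xs_def S0N)
  then have lX: "2 * k \<le> length X1" "length X2 = 2 * k" by (auto simp: X1_def X2_def)
  define Rem where "Rem = e \<union> set u \<union> Q \<union> B a"
  define rest where "rest = sorted_list_of_set ({0..<N} - Rem)"
  have fRem: "finite Rem" using fe Q by (simp add: Rem_def)
  \<comment> \<open>This bound on the vertices missing from \<open>rest\<close> is the
    \<open>5 * k\<close> in \<open>D = k + 5 * k\<close>.\<close>
  have cRem: "card Rem \<le> 5 * k"
  proof -
    have "card Rem \<le> card e + card (set u) + card Q + card (B a)"
      unfolding Rem_def by (intro card_Un_le[THEN le_trans] add_mono order_refl)
    moreover have "card (set u) \<le> 2 * k" using card_length[of u] lu by linarith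
    ultimately show ?thesis using Q(1) e(2) card_B[of a] by linarith
  qed
  have setrest: "set rest = {0..<N} - Rem" by (simp add: rest_def)
  define mid where "mid = X1 @ rest @ X2"
  define Yl where "Yl = sorted_list_of_set (Y a)"
  define Zl where "Zl = c' # sorted_list_of_set (B a - Y a - P a)"
  define Pl where "Pl = sorted_list_of_set (P a)"
  define Ql where "Ql = sorted_list_of_set Q"
  define Ll where "Ll = sorted_list_of_set L"
  define Ml where "Ml = sorted_list_of_set (e - L - R)"
  define Rl where "Rl = sorted_list_of_set R"
  have sets: "set Yl = Y a" "set Zl = insert c' (B a - Y a - P a)" "set Pl = P a" "set Ql = Q"
    "set Ll = L" "set Ml = e - L - R" "set Rl = R" "set mid = (S0 - e - {c'}) \<union> ({0..<N} - Rem)"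
    using fL fR fe Q setX setrest
    by (auto simp: Yl_def Zl_def Pl_def Ql_def Ll_def Ml_def Rl_def mid_def)
  have B_split: "Y a \<union> (B a - Y a - P a) \<union> P a = B a" using P_sub[of a] Y_sub[of a] by blast
  have c'B: "c' \<notin> B a" using c'N BN by auto
  have dlists: "distinct Yl" "distinct Zl" "distinct Pl" "distinct Ql" "distinct Ll" "distinct Ml" "distinct Rl"
    using c'B by (simp_all add: Yl_def Zl_def Pl_def Ql_def Ll_def Ml_def Rl_def)
  have dmid: "distinct mid"
    unfolding mid_def distinct_append set_append
  proof (intro conjI)
    show "distinct rest" by (simp add: rest_def)
    have "set rest \<inter> (set X1 \<union> set X2) = {}" unfolding setX setrest S0N by auto
    then show "set rest \<inter> set X2 = {}" "set X1 \<inter> (set rest \<union> set X2) = {}" using dX by blast+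
  qed (use dX in auto)
  have mid_dis: "set mid \<inter> Rem = {}"
    unfolding sets Rem_def using uN BN QN by (fastforce simp: S0N)
  have c'_mid: "c' \<notin> set mid" using c'N by (auto simp: sets)
  have YP: "P a \<subseteq> B a" "Y a \<subseteq> B a" "P a \<inter> Y a = {}" by (rule P_sub Y_sub PY)+
  have c'u: "c' \<notin> set u" "c' \<notin> Q" using c'N uN QN by auto
  have left_set: "set (Ll @ Ml @ Rl @ u) = e \<union> set u"
  proof -
    have "set (Ll @ Ml @ Rl @ u) = L \<union> (e - L - R) \<union> R \<union> set u" by (auto simp only: set_append sets Un_iff)
    then show ?thesis using R(1) L(1) by blast
  qed
  have right_set: "set (mid @ Yl @ Zl @ Pl @ Ql) = set mid \<union> insert c' (B a \<union> Q)"
    unfolding set_append sets using B_split by blast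
  have dist: "distinct (Ll @ Ml @ (Rl @ u) @ mid @ Yl @ Zl @ Pl @ Ql)"
  proof -
    have 1: "distinct (Yl @ Zl @ Pl @ Ql)"
      using dlists YP c'B c'u QB by (auto simp: sets)
    have "set (Yl @ Zl @ Pl @ Ql) = insert c' (B a \<union> Q)" using B_split by (auto simp: sets)
    then have "set mid \<inter> set (Yl @ Zl @ Pl @ Ql) = {}" using mid_dis c'_mid by (auto simp: Rem_def)
    then have 2: "distinct (mid @ Yl @ Zl @ Pl @ Ql)" using dmid 1 by (simp only: distinct_append)
    have 3: "distinct (Ll @ Ml @ Rl @ u)" using dlists du R L ue by (auto simp: sets)
    have "set (Ll @ Ml @ Rl @ u) \<inter> set (mid @ Yl @ Zl @ Pl @ Ql) = {}"
      unfolding left_set right_set using mid_dis Be Bu Qu Q(4) c'e c'u by (auto simp: Rem_def)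
    then have "distinct ((Ll @ Ml @ Rl @ u) @ mid @ Yl @ Zl @ Pl @ Ql)" using 2 3 by (simp only: distinct_append)
    then show ?thesis by simp
  qed
  have all: "set (Ll @ Ml @ (Rl @ u) @ mid @ Yl @ Zl @ Pl @ Ql) = {0..<n}"
  proof -
    have "set (Ll @ Ml @ (Rl @ u) @ mid @ Yl @ Zl @ Pl @ Ql) =
        set (Ll @ Ml @ Rl @ u) \<union> set (mid @ Yl @ Zl @ Pl @ Ql)"
      by (simp only: set_append Un_assoc)
    also have "\<dots> = insert c' (Rem \<union> set mid)"
      unfolding left_set right_set Rem_def by blast
    also have "\<dots> = insert c' (e \<union> {0..<N} \<union> S0)"
      unfolding sets Rem_def using uN BN QN by (auto simp: S0N)
    also have "\<dots> = {0..<n}"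
    proof (intro set_eqI iffI)
      fix v assume "v \<in> insert c' (e \<union> {0..<N} \<union> S0)"
      then show "v \<in> {0..<n}" using c'N e N c_less by (auto simp: S0N)
    next
      fix v assume v: "v \<in> {0..<n}"
      have "v \<in> e \<or> v < N \<or> v \<in> S0 \<or> v = c" using v by (auto simp: S0N c_def)
      then show "v \<in> insert c' (e \<union> {0..<N} \<union> S0)" using c'c by auto
    qed
    finally show ?thesis .
  qed
  have below_c: "set (mid @ Yl) \<subseteq> {0..<c}"
    using N BN YP by (auto simp: sets S0N)
  show ?thesis
  proof (rule hamiltonian_assembly[OF dvd _ lk dist all])
    show "0 < l" using l_ge by simp
    show "length Ll = l" "length Yl = l" "length Pl = l" "length Ql = k - 2 * l"
      using L Q by (simp_all add: Ll_def Yl_def Pl_def Ql_def card_Y card_P)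
    show "length Ml = k - 2 * l"
    proof -
      have "card (e - L) = k - l" using fL L e by (simp add: card_Diff_subset)
      then have "card (e - L - R) = k - l - l" using fR R by (simp add: card_Diff_subset)
      then show ?thesis by (simp add: Ml_def)
    qed
    show lZ: "length Zl = k - 2 * l"
    proof -
      have "card (B a - Y a) = k - 1 - l" using YP by (simp add: card_Diff_subset card_B card_Y)
      moreover have "P a \<subseteq> B a - Y a" using YP by blast
      ultimately have "card (B a - Y a - P a) = k - 1 - l - l" by (simp add: card_Diff_subset card_P)
      then show ?thesis using lk by (simp add: Zl_def)
    qed
    have lR: "length Rl = l" using R by (simp add: Rl_def)
    then show "l \<le> length (Rl @ u)" "length (Rl @ u) \<le> 2 * (k - l)" using lu by simp_all
    show "2 * k \<le> length mid" using lX by (simp add: mid_def)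
    have "set (Ll @ Ml @ take l (Rl @ u)) = e" using lR L R by (auto simp: sets)
    then show "set (Ll @ Ml @ take l (Rl @ u)) \<in> insert e H0" by simp
    have "set (take k (Rl @ u @ X1)) \<in> H0 \<and> set (take k (drop (k - l) (Rl @ u @ X1))) \<in> H0"
      using u(1) dX(1) setX lX(1) dlists(7) sets(7) unfolding leads_def by blast
    moreover have "take k ((Rl @ u) @ mid) = take k (Rl @ u @ X1)" using lX by (simp add: mid_def)
    moreover have "take k (drop (k - l) ((Rl @ u) @ mid)) = take k (drop (k - l) (Rl @ u @ X1))"
    proof -
      have "(Rl @ u) @ mid = (Rl @ u @ X1) @ rest @ X2" by (simp add: mid_def)
      moreover have "k \<le> length (drop (k - l) (Rl @ u @ X1))" using lX by simp
      ultimately show ?thesis by (simp del: append_assoc length_drop)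
    qed
    ultimately show "set (take k ((Rl @ u) @ mid)) \<in> insert e H0"
      "set (take k (drop (k - l) ((Rl @ u) @ mid))) \<in> insert e H0" by simp_all
    show "set (Pl @ Ql @ Ll) \<in> insert e H0"
    proof -
      have "set (Pl @ Ql @ Ll) = L \<union> Q \<union> P a" by (auto simp: sets)
      then show ?thesis using Q(5) by (auto simp: H0_def)
    qed
    have aT: "a < T" using a bT by simp
    show "set (Yl @ Zl @ Pl) \<in> insert e H0"
    proof -
      have eq: "set (Yl @ Zl @ Pl) = insert c' (B a)" using B_split by (auto simp: sets)
      have "insert c' (B a) \<in> H0"
      proof (cases "c \<in> e")
        case False
        then show ?thesis using c'c a aT by (auto simp: H0_def)
      next
        case True
        then have c'S0: "c' \<in> S0" by (rule c'c)
        have "set (Yl @ Zl @ Pl) \<in> H0"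
        proof (rule live_window)
          show "distinct (Yl @ Zl @ Pl)" using dlists YP c'B by (auto simp: sets)
          show "length (Yl @ Zl @ Pl) = k" using lZ lk by (simp add: Yl_def Pl_def card_Y card_P)
          show "set (Yl @ Zl @ Pl) \<subseteq> {0..<c}" unfolding eq using BN N c'S0 by (auto simp: S0N)
          have "set (Yl @ Zl @ Pl) - Om = B a"
            unfolding eq using c'S0 S0_Om B_Om[OF aT] by auto
          moreover have "card (B a) \<noteq> l" using card_B[of a] lk l_ge by simp
          ultimately show "(\<exists>x. set (Yl @ Zl @ Pl) - Om \<subseteq> {x..<x + D}) \<or>
            (\<exists>a<T. set (Yl @ Zl @ Pl) - Om \<subseteq> B a \<and>
              (card (set (Yl @ Zl @ Pl) - Om) = l \<longrightarrow> set (Yl @ Zl @ Pl) - Om = Y a)) \<or>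
            P T \<subseteq> set (Yl @ Zl @ Pl) \<and> card (set (Yl @ Zl @ Pl) - Om - P T) < l \<or>
            set (Yl @ Zl @ Pl) - Om \<subseteq> P T" using aT by (intro disjI2 disjI1 exI[of _ a]) simp
        qed
        then show ?thesis unfolding eq .
      qed
      then show ?thesis unfolding eq by simp
    qed
    fix i assume i: "i + k \<le> length (mid @ Yl)"
    define w where "w = take k (drop i (mid @ Yl))"
    have "set mid \<inter> set Yl = {}" using mid_dis YP(2) unfolding Rem_def sets(1) by blast
    then have "distinct (mid @ Yl)" using dmid dlists(1) by simp
    then have dw: "distinct w" unfolding w_def by (intro distinct_take distinct_drop)
    have lw: "length w = k" using i by (simp add: w_def)
    have cw: "set w \<subseteq> {0..<c}"
      unfolding w_def by (rule subset_trans[OF set_take_subset subset_trans[OF set_drop_subset below_c]])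
    have XOm: "set X1 \<union> set X2 \<subseteq> Om" using setX S0_Om by blast
    have "set w \<in> H0"
    \<comment> \<open>A window starting before the end of \<open>rest\<close> does not get beyond
      \<open>X2\<close>, so outside \<open>Om\<close> it has only entries of \<open>rest\<close>. A
      later window has only vertices of \<open>Y a\<close> there, and \<open>l\<close> of them are
      all of \<open>Y a\<close>.\<close>
    proof (cases "i < length X1 + length rest")
      case True
      define m where "m = k - length (drop i X1)"
      define j where "j = i - length X1"
      have w: "w = take k (drop i X1) @ take m (drop j rest) @ take (m - length (drop j rest)) X2"
        using True lX by (simp add: w_def mid_def m_def j_def)
      obtain x where "set (take m (drop j rest)) \<subseteq> {x..<x + (k + 5 * k)}"
        using sorted_window[OF fRem cRem _ rest_def, of m k j] by (auto simp: m_def)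
      moreover have "set w - Om \<subseteq> set (take m (drop j rest))"
        unfolding w using XOm set_take_subset[of k "drop i X1"] set_drop_subset[of i X1]
          set_take_subset[of "m - length (drop j rest)" X2] by auto
      ultimately have "set w - Om \<subseteq> {x..<x + D}" by (auto simp: D_def)
      then show ?thesis by (intro live_window[OF dw lw cw]) blast
    next
      case False
      define j where "j = i - length X1 - length rest"
      have "drop i (mid @ Yl) = drop j (X2 @ Yl)" using False by (simp add: mid_def j_def)
      then have "set w \<subseteq> set (X2 @ Yl)"
        unfolding w_def by (metis set_take_subset set_drop_subset subset_trans)
      then have "set w - Om \<subseteq> Y a" using XOm by (auto simp: sets)
      moreover from this have "card (set w - Om) = l \<longrightarrow> set w - Om = Y a"
        using card_subset_eq[OF finite_sets(3)] card_Y by metis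
      ultimately show ?thesis using aT YP(2) by (intro live_window[OF dw lw cw] disjI2 disjI1 exI[of _ a]) auto
    qed
    then show "set (take k (drop i (mid @ Yl))) \<in> insert e H0" by (simp add: w_def)
  qed
qed

end

section \<open>The bound on the saturation number\<close>

theorem theorem1p1:
  fixes k l :: nat
  assumes "2 \<le> l" and "2 * l < k"
  defines "p \<equiv> max l (max (k - 2 * l - 1) ((k + 1) div 2 - l))"
  shows "\<exists>C::real. C > 0 \<and> (\<exists>n0::nat. \<forall>n \<ge> n0. (k - l) dvd n \<longrightarrow>
           (\<exists>H. ham_saturated n k l H) \<and> real (sat n k l) \<le> C * real n ^ p)"
proof -
  define q where "q = 36 * k * k"
  \<comment> \<open>The exponent bounds the size of the sets \<open>nb\<close>, using
    \<open>n - q * T \<le> 2 * q + 6 * k + 2\<close>.\<close>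
  define C :: nat where "C = 2 ^ (2 * q + 6 * k + 2 + l * (q * k))"
  have q: "0 < q" using assms by (simp add: q_def)
  have "(\<exists>H. ham_saturated n k l H) \<and> real (sat n k l) \<le> real C * real n ^ p"
    if n: "q + 6 * k + 2 \<le> n" and dvd: "(k - l) dvd n" for n
  proof -
    \<comment> \<open>The number of blocks is as large as the locale permits, so only boundedly many
      vertices lie above \<open>s * T\<close>.\<close>
    define T where "T = (n - (6 * k + 2)) div q - 1"
    have "1 \<le> (n - (6 * k + 2)) div q" using div_le_mono[of q "n - (6 * k + 2)" q] n q by simp
    then have T: "(n - (6 * k + 2)) div q = T + 1" by (simp add: T_def)
    have "q * (T + 1) \<le> n - (6 * k + 2)" unfolding T[symmetric] by simp
    then interpret ham_construction k l n T
      by unfold_locales (use assms n in \<open>auto simp: q_def\<close>)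
    have s_eq: "s = q" by (simp add: s_def D_def q_def)
    have "n - (6 * k + 2) < q * (T + 2)"
      using dividend_less_times_div[OF q, of "n - (6 * k + 2)"] unfolding T by simp
    then have bound: "n - q * T \<le> 2 * q + 6 * k + 2" by (simp add: algebra_simps)
    obtain H where H: "ham_saturated n k l H" "card H \<le> card narrow"
    proof (rule saturated_extension[OF kgraph_H0 H0_not_hamiltonian H0_narrow card_narrow(1)])
      fix e assume "e \<subseteq> {0..<n}" "card e = k" "e \<notin> narrow"
      then show "hamiltonian n k l (insert e H0)" by (intro wide_hamiltonian[OF dvd]) (auto simp: narrow_def)
    qed
    have "sat n k l \<le> card H" unfolding sat_def using H(1) by (intro Least_le) blast
    also have "\<dots> \<le> n ^ l * 2 ^ (n - q * T + l * (q * k))" using H(2) card_narrow(2) unfolding s_eq by linarith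
    also have "\<dots> \<le> n ^ p * C"
    proof (rule mult_le_mono)
      show "n ^ l \<le> n ^ p" by (rule power_increasing) (use n in \<open>auto simp: p_def\<close>)
      show "2 ^ (n - q * T + l * (q * k)) \<le> C" unfolding C_def by (rule power_increasing) (use bound in auto)
    qed
    finally have "real (sat n k l) \<le> real (n ^ p * C)" by (rule of_nat_mono)
    then show ?thesis using H by (auto simp: mult.commute)
  qed
  moreover have "0 < real C" by (simp add: C_def)
  ultimately show ?thesis by blast
qed

end
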